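(* The following claims hold: 1) The function $$\nu\mapsto{}_3F_2\left(-\tfrac12,\tfrac12,\tfrac32;\,1,\nu+\tfrac12;\,1\right)$$ has a unique positive zero $\nu_0$, which is located in $(0,1/2)$. 2) For $\nu>0$ we have $$\sigma_{\mathrm p}(J_\nu)=\begin{cases}\emptyset,&\text{if }\nu\ge\nu_0,\\ \left\{\tfrac14-x_0^2(\nu)\right\},&\text{if }0<\nu<\nu_0,\end{cases}$$ where $x_0(\nu)$ is the unique zero of the function $$x\mapsto{}_3F_2\left(x-\tfrac12,x+\tfrac12,x+\tfrac32;\,2x+1,x+\nu+\tfrac12;\,1\right)$$ located in $(0,1/2)$. 3) The function $x_0:(0,\nu_0)\to(0,1/2):\nu\mapsto x_0(\nu)$ is real analytic and strictly decreasing.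
   Context: $\sigma_{\mathrm p}$ denotes the point spectrum (set of eigenvalues); $\mathbb{N}_0=\{0,1,2,\dots\}$. The hypergeometric function at unit argument is ${}_3F_2(a_1,a_2,a_3;b_1,b_2;1)=\sum_{k=0}^\infty\frac{(a_1)_k(a_2)_k(a_3)_k}{k!\,(b_1)_k(b_2)_k}$, with $(a)_k=a(a+1)\cdots(a+k-1)$, for $\mathrm{Re}(b_1+b_2-a_1-a_2-a_3)>0$. For $\nu>0$ put $b_n(\nu)=(n+\nu)(n+\nu+1)$, $n\in\mathbb{N}_0$, and let $\mathcal{J}_\nu$ be the semi-infinite tridiagonal matrix indexed by $\mathbb{N}_0$ with $(\mathcal{J}_\nu)_{0,0}=b_0(\nu)$, $(\mathcal{J}_\nu)_{n,n}=b_{n-1}(\nu)+b_n(\nu)$ for $n\ge1$, $(\mathcal{J}_\nu)_{n,n+1}=(\mathcal{J}_\nu)_{n+1,n}=-b_n(\nu)$ for $n\ge0$, and all other entries $0$. $J_\nu$ is the self-adjoint operator on $\ell^2(\mathbb{N}_0)$ acting by $J_\nu x=\mathcal{J}_\nu\cdot x$ on $\{x\in\ell^2(\mathbb{N}_0):\mathcal{J}_\nu\cdot x\in\ell^2(\mathbb{N}_0)\}$. *)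

theory Defs
  imports "HOL-Analysis.Analysis"
begin

text \<open>Meaningful only when the series converges, e.g. if the real part of
  \<open>b1 + b2 - a1 - a2 - a3\<close> is positive and neither \<open>b1\<close> nor \<open>b2\<close> is a nonpositive integer.\<close>

definition hyp3F2_at_1 ::
  "'a \<Rightarrow> 'a \<Rightarrow> 'a \<Rightarrow> 'a \<Rightarrow> 'a \<Rightarrow> 'a :: {real_normed_field, banach}" where
  "hyp3F2_at_1 a1 a2 a3 b1 b2 =
     (\<Sum>k. pochhammer a1 k * pochhammer a2 k * pochhammer a3 k
             / (fact k * pochhammer b1 k * pochhammer b2 k))"

definition ell2 :: "(nat \<Rightarrow> complex) set" where
  "ell2 = {x. summable (\<lambda>n. (cmod (x n))\<^sup>2)}"

definition jacobi_b :: "real \<Rightarrow> nat \<Rightarrow> real" where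
  "jacobi_b \<nu> n = (real n + \<nu>) * (real n + \<nu> + 1)"

definition jacobi_matrix :: "real \<Rightarrow> nat \<Rightarrow> nat \<Rightarrow> real" where
  "jacobi_matrix \<nu> m n =
     (if m = n then (if n = 0 then jacobi_b \<nu> 0 else jacobi_b \<nu> (n - 1) + jacobi_b \<nu> n)
      else if n = m + 1 then - jacobi_b \<nu> m
      else if m = n + 1 then - jacobi_b \<nu> n
      else 0)"

text \<open>All rows of \<^const>\<open>jacobi_matrix\<close> are finitely supported, so the series below is a finite sum
  for every sequence \<open>x\<close>.\<close>

definition jacobi_op :: "real \<Rightarrow> (nat \<Rightarrow> complex) \<Rightarrow> (nat \<Rightarrow> complex)" where
  "jacobi_op \<nu> x = (\<lambda>m. \<Sum>n. complex_of_real (jacobi_matrix \<nu> m n) * x n)"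

definition jacobi_dom :: "real \<Rightarrow> (nat \<Rightarrow> complex) set" where
  "jacobi_dom \<nu> = {x \<in> ell2. jacobi_op \<nu> x \<in> ell2}"

text \<open>Point spectrum of an operator \<open>T\<close> with domain \<open>D\<close>, both given on sequences.\<close>

definition point_spectrum ::
  "(nat \<Rightarrow> complex) set \<Rightarrow> ((nat \<Rightarrow> complex) \<Rightarrow> (nat \<Rightarrow> complex)) \<Rightarrow> complex set" where
  "point_spectrum D T = {z. \<exists>x\<in>D. x \<noteq> (\<lambda>n. 0) \<and> T x = (\<lambda>n. z * x n)}"

text \<open>Local representability by a convergent power series; \<open>S\<close> is meant to be open.\<close>

definition real_analytic_on :: "(real \<Rightarrow> real) \<Rightarrow> real set \<Rightarrow> bool" where
  "real_analytic_on f S \<longleftrightarrow> (\<forall>c\<in>S. \<exists>F. (\<lambda>h. f (c + h)) has_fps_expansion F)"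

end

theory Submission
  imports Defs "HOL-Complex_Analysis.Complex_Analysis"
begin

text \<open>Put \<open>s = x + 1/2\<close>, so that an eigenvalue \<open>1/4 - x\<^sup>2\<close> equals \<open>s (1 - s)\<close>. The eigenvalue
  recurrence has an explicit solution \<open>phi\<close> decaying like \<open>n\<close> to the power \<open>- s\<close>, a
  hypergeometric series at argument \<open>1\<close>, whose flux \<open>psi\<close> is contiguous to it; the boundary condition
  at \<open>0\<close> says that \<open>psi\<close> vanishes there, which is the equation in the theorem. A Wronskian argument
  along a subsequence shows that every square summable eigenvector forces this equation, also on the
  critical line \<open>Re s = 1/2\<close>, where \<open>phi\<close> is not square summable; so there are no eigenvalues in
  \<open>[1/4, \<infinity>)\<close>. For real \<open>s\<close> all terms of \<open>phi\<close> are positive. Testing two such positive decreasing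
  solutions against each other gives uniqueness of the zero, strict monotonicity and a Lipschitz bound
  in \<open>\<nu>\<close>. The Lipschitz bound, together with a lower bound for the growth of the characteristic function in
  \<open>\<nu>\<close>, shows that its \<open>x\<close>-derivative does not vanish on the zero curve, which is therefore analytic.\<close>

text \<open>The matrix is a difference operator with coefficients \<open>jacobi_b\<close>, so its
  rows telescope: an eigenvector is a sequence whose flux is minus the eigenvalue times its partial
  sums. Boundary terms are estimated through these partial sums, since square summability makes them
  small against the square root of n, whereas single entries are that small only along a
  subsequence. In the comparison, two solutions for different \<nu> yield one positive sequence
  \<open>D\<close> of products of differences and one number \<open>P\<close>; summing
  \<open>D\<close> against the coefficients of either parameter gives the corresponding eigenvalue
  times \<open>P\<close>. Ordered coefficients thus force ordered eigenvalues. The threshold is the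
  \<nu> at which x = 0 solves the equation. The obstacle to analyticity is that x occurs in all five
  parameters, so the series shows no sign of its x-derivative.\<close>

section \<open>Hypergeometric terms and their decay\<close>

text \<open>The factorial of the series is kept as a denominator parameter, since
  \<open>pochhammer 1 k = fact k\<close>; an index shift turns this parameter into 2 without leaving
  the format.\<close>

definition poch_ratio ::
  "'a \<Rightarrow> 'a \<Rightarrow> 'a \<Rightarrow> 'a \<Rightarrow> 'a \<Rightarrow> 'a \<Rightarrow> nat \<Rightarrow> 'a :: {real_normed_field, banach}" where
  "poch_ratio a1 a2 a3 b1 b2 b3 k =
     pochhammer a1 k * pochhammer a2 k * pochhammer a3 k
       / (pochhammer b1 k * pochhammer b2 k * pochhammer b3 k)"

lemma hyp3F2_at_1_eq_suminf: "hyp3F2_at_1 a1 a2 a3 b1 b2 = (\<Sum>k. poch_ratio a1 a2 a3 1 b1 b2 k)"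
  by (simp add: hyp3F2_at_1_def poch_ratio_def pochhammer_fact)

lemma poch_ratio_0 [simp]: "poch_ratio a1 a2 a3 b1 b2 b3 0 = 1"
  by (simp add: poch_ratio_def)

lemma poch_ratio_of_real:
  "poch_ratio (of_real a1) (of_real a2) (of_real a3) (of_real b1) (of_real b2) (of_real b3) k
     = (of_real (poch_ratio a1 a2 a3 b1 b2 b3 k) :: 'a :: {real_normed_field, banach})"
  by (simp add: poch_ratio_def pochhammer_of_real)

lemma Re_pos_not_nonpos_Ints: "0 < Re z \<Longrightarrow> z \<notin> \<int>\<^sub>\<le>\<^sub>0"
  by (auto elim!: nonpos_Ints_cases)

lemma pochhammer_neq_0_of_not_nonpos_Ints:
  "(z :: complex) \<notin> \<int>\<^sub>\<le>\<^sub>0 \<Longrightarrow> pochhammer z k \<noteq> 0"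
  using pochhammer_eq_0_imp_nonpos_Int by blast

text \<open>Quotient of the Euler limits for \<open>Gamma b\<close> and \<open>Gamma a\<close>, in
  which the factorials cancel.\<close>

lemma pochhammer_ratio_asymp:
  fixes a b :: complex
  assumes a: "a \<notin> \<int>\<^sub>\<le>\<^sub>0" and b: "b \<notin> \<int>\<^sub>\<le>\<^sub>0"
  shows "(\<lambda>k. pochhammer a k / pochhammer b k * exp ((b - a) * of_real (ln (real k))))
           \<longlonglongrightarrow> Gamma b / Gamma a"
proof -
  have "(\<lambda>k. Gamma_series' b k / Gamma_series' a k) \<longlonglongrightarrow> Gamma b / Gamma a"
    using a by (intro tendsto_divide Gamma_series'_LIMSEQ) (auto simp: Gamma_eq_zero_iff)
  moreover have "Gamma_series' b k / Gamma_series' a k =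
      pochhammer a k / pochhammer b k * exp ((b - a) * of_real (ln (real k)))" for k
    by (simp add: Gamma_series'_def left_diff_distrib exp_diff field_simps)
  ultimately show ?thesis by simp
qed

lemma norm_exp_times_ln:
  assumes "k > 0"
  shows "norm (exp (z * of_real (ln (real k)))) = real k powr Re z"
  using assms by (simp add: powr_def)

lemma poch_ratio_asymp:
  fixes a1 a2 a3 b1 b2 b3 :: complex
  assumes a: "a1 \<notin> \<int>\<^sub>\<le>\<^sub>0" "a2 \<notin> \<int>\<^sub>\<le>\<^sub>0" "a3 \<notin> \<int>\<^sub>\<le>\<^sub>0"
    and b: "b1 \<notin> \<int>\<^sub>\<le>\<^sub>0" "b2 \<notin> \<int>\<^sub>\<le>\<^sub>0" "b3 \<notin> \<int>\<^sub>\<le>\<^sub>0"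
  obtains C where "(\<lambda>k. norm (poch_ratio a1 a2 a3 b1 b2 b3 k)
                          * real k powr Re (b1 + b2 + b3 - a1 - a2 - a3)) \<longlonglongrightarrow> C"
proof -
  define e where "e = b1 + b2 + b3 - a1 - a2 - a3"
  let ?r = "\<lambda>a b k. pochhammer a k / pochhammer b k * exp ((b - a) * of_real (ln (real k)))"
  define C where "C = Gamma b1 / Gamma a1 * (Gamma b2 / Gamma a2) * (Gamma b3 / Gamma a3)"
  have "(\<lambda>k. ?r a1 b1 k * ?r a2 b2 k * ?r a3 b3 k) \<longlonglongrightarrow> C"
    unfolding C_def by (intro tendsto_mult pochhammer_ratio_asymp a b)
  moreover have "?r a1 b1 k * ?r a2 b2 k * ?r a3 b3 k
      = poch_ratio a1 a2 a3 b1 b2 b3 k * exp (e * of_real (ln (real k)))" for k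
  proof -
    have "exp (e * of_real (ln (real k))) = exp ((b1 - a1) * of_real (ln (real k)))
        * exp ((b2 - a2) * of_real (ln (real k))) * exp ((b3 - a3) * of_real (ln (real k)))"
      unfolding e_def by (simp flip: exp_add add: algebra_simps)
    then show ?thesis by (simp add: poch_ratio_def)
  qed
  ultimately have "(\<lambda>k. norm (poch_ratio a1 a2 a3 b1 b2 b3 k * exp (e * of_real (ln (real k)))))
      \<longlonglongrightarrow> norm C"
    by (simp add: tendsto_norm)
  then have "(\<lambda>k. norm (poch_ratio a1 a2 a3 b1 b2 b3 k) * real k powr Re e) \<longlonglongrightarrow> norm C"
    by (rule Lim_transform_eventually)
       (use norm_exp_times_ln in \<open>auto simp: norm_mult intro!: eventually_sequentiallyI[of 1]\<close>)
  then show thesis using that unfolding e_def by blast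
qed

text \<open>The terms decay like k to the power minus the left side of \<open>e\<close>. With
  \<open>b1 = 1\<close> the condition says that the parametric excess has positive real part. The
  second claim removes the boundary term of the telescoping sum in
  \<open>hyp_P_diff\<close>.\<close>

lemma
  fixes a1 a2 a3 b1 b2 b3 :: complex
  assumes a: "a1 \<notin> \<int>\<^sub>\<le>\<^sub>0" "a2 \<notin> \<int>\<^sub>\<le>\<^sub>0" "a3 \<notin> \<int>\<^sub>\<le>\<^sub>0"
    and b: "b1 \<notin> \<int>\<^sub>\<le>\<^sub>0" "b2 \<notin> \<int>\<^sub>\<le>\<^sub>0" "b3 \<notin> \<int>\<^sub>\<le>\<^sub>0"
    and e: "Re (b1 + b2 + b3 - a1 - a2 - a3) > 1"
  shows summable_norm_poch_ratio: "summable (\<lambda>k. norm (poch_ratio a1 a2 a3 b1 b2 b3 k))"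
    and poch_ratio_times_index_tendsto_0:
      "(\<lambda>k. of_nat k * poch_ratio a1 a2 a3 b1 b2 b3 k) \<longlonglongrightarrow> 0"
proof -
  define e where "e = Re (b1 + b2 + b3 - a1 - a2 - a3)"
  have e1: "e > 1" using assms(7) by (simp add: e_def)
  let ?T = "poch_ratio a1 a2 a3 b1 b2 b3"
  obtain C where C: "(\<lambda>k. norm (?T k) * real k powr e) \<longlonglongrightarrow> C"
    using poch_ratio_asymp[OF a b] unfolding e_def by blast
  then have "Bseq (\<lambda>k. norm (?T k) * real k powr e)"
    using convergent_imp_Bseq convergentI by blast
  then obtain K where K: "K > 0" "\<And>k. norm (norm (?T k) * real k powr e) \<le> K"
    by (auto simp: Bseq_def)
  have bd: "norm (?T k) \<le> K * real k powr (- e)" if "k \<ge> 1" for k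
    using K(2)[of k] that by (simp add: powr_minus field_simps)
  have "summable (\<lambda>k. K * real k powr (- e))"
    using e1 by (intro summable_mult) (simp add: summable_real_powr_iff)
  then show "summable (\<lambda>k. norm (?T k))"
    by (rule summable_comparison_test'[where N = 1]) (use bd in auto)
  have "(\<lambda>k. K * real k powr (1 - e)) \<longlonglongrightarrow> 0"
    using tendsto_mult_right_zero[OF tendsto_neg_powr[OF _ filterlim_real_sequentially], of "1 - e" K] e1
    by simp
  then show "(\<lambda>k. of_nat k * ?T k) \<longlonglongrightarrow> 0"
  proof (rule Lim_null_comparison[OF eventually_sequentiallyI[of 1], rotated])
    fix k :: nat assume k: "1 \<le> k"
    have "norm (of_nat k * ?T k) \<le> real k * (K * real k powr (- e))"
      using bd[OF k] by (simp add: norm_mult mult_left_mono)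
    also have "\<dots> = K * real k powr (1 - e)"
      using k by (simp add: powr_diff powr_minus field_simps)
    finally show "norm (of_nat k * ?T k) \<le> K * real k powr (1 - e)" .
  qed
qed

lemma summable_poch_ratio_real:
  fixes a1 a2 a3 b1 b2 b3 :: real
  assumes "a1 > 0" "a2 > 0" "a3 > 0" "b1 > 0" "b2 > 0" "b3 > 0"
    and "b1 + b2 + b3 - a1 - a2 - a3 > 1"
  shows "summable (poch_ratio a1 a2 a3 b1 b2 b3)"
proof -
  have "summable (\<lambda>k. norm (poch_ratio (complex_of_real a1) (of_real a2) (of_real a3)
                                        (of_real b1) (of_real b2) (of_real b3) k))"
    using assms by (intro summable_norm_poch_ratio Re_pos_not_nonpos_Ints) auto
  then show ?thesis
    unfolding poch_ratio_of_real by (simp add: summable_rabs_cancel)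
qed

subsection \<open>Contiguous relations\<close>

definition hyp_P :: "complex \<Rightarrow> complex \<Rightarrow> complex" where
  "hyp_P s N = hyp3F2_at_1 s s (s + 1) (2 * s) (N + 1 + s)"

text \<open>At \<open>s = x + 1/2\<close> and \<open>N = \<nu>\<close> this is the function of the
  theorem. Its parametric excess is \<open>N\<close>, and so is that of
  \<open>hyp_P\<close>.\<close>

definition hyp_Q :: "complex \<Rightarrow> complex \<Rightarrow> complex" where
  "hyp_Q s N = hyp3F2_at_1 (s - 1) s (s + 1) (2 * s) (N + s)"

lemma Re_pos_minus_1_not_nonpos_Ints:
  assumes "0 < Re s" "s \<noteq> 1"
  shows "s - 1 \<notin> \<int>\<^sub>\<le>\<^sub>0"
proof
  assume "s - 1 \<in> \<int>\<^sub>\<le>\<^sub>0"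
  then obtain n where n: "s - 1 = of_int n" "n \<le> 0" by (auto elim: nonpos_Ints_cases)
  then have "Re s = real_of_int (n + 1)" 
    by (metis Re_complex_of_real add_diff_cancel diff_add_cancel of_int_1 of_int_add of_real_of_int_eq)
  with assms(1) have "n + 1 > 0" by simp
  with n assms(2) show False by auto
qed

lemma summable_hyp_P:
  assumes "Re s > 0" "Re N > 0"
  shows "summable (\<lambda>k. norm (poch_ratio s s (s + 1) 1 (2 * s) (N + 1 + s) k))"
  using assms by (intro summable_norm_poch_ratio Re_pos_not_nonpos_Ints) auto

lemma summable_hyp_Q:
  assumes "Re s > 0" "s \<noteq> 1" "Re N > 0"
  shows "summable (\<lambda>k. norm (poch_ratio (s - 1) s (s + 1) 1 (2 * s) (N + s) k))"
  using assms
  by (intro summable_norm_poch_ratio Re_pos_not_nonpos_Ints Re_pos_minus_1_not_nonpos_Ints) auto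

lemma sums_hyp_P:
  assumes "Re s > 0" "Re N > 0"
  shows "poch_ratio s s (s + 1) 1 (2 * s) (N + 1 + s) sums hyp_P s N"
  unfolding hyp_P_def hyp3F2_at_1_eq_suminf
  using assms by (intro summable_sums summable_norm_cancel[OF summable_hyp_P])

lemma sums_hyp_Q:
  assumes "Re s > 0" "s \<noteq> 1" "Re N > 0"
  shows "poch_ratio (s - 1) s (s + 1) 1 (2 * s) (N + s) sums hyp_Q s N"
  unfolding hyp_Q_def hyp3F2_at_1_eq_suminf
  using assms by (intro summable_sums summable_norm_cancel[OF summable_hyp_Q])

lemma of_nat_add_neq_0:
  assumes "0 < Re z"
  shows "z + of_nat k \<noteq> 0"
  using assms by (auto simp: complex_eq_iff)

text \<open>Holds term by term: over the common denominator \<open>pochhammer (N + 1 + s) k\<close>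
  the coefficients \<open>N + 1\<close> and \<open>N + s\<close> combine to
  \<open>- (s - 1 + k)\<close>, which raises the parameter \<open>s - 1\<close> to
  \<open>s\<close>.\<close>

lemma hyp_Q_diff:
  assumes s: "Re s > 0" "s \<noteq> 1" and N: "Re N > 0"
  shows "(N + 1) * hyp_Q s (N + 1) - (N + s) * hyp_Q s N = (1 - s) * hyp_P s N"
proof -
  have Q1: "poch_ratio (s - 1) s (s + 1) 1 (2 * s) (N + 1 + s) sums hyp_Q s (N + 1)"
    using sums_hyp_Q[of s "N + 1"] s N by simp
  have "(\<lambda>k. (N + 1) * poch_ratio (s - 1) s (s + 1) 1 (2 * s) (N + 1 + s) k
          - (N + s) * poch_ratio (s - 1) s (s + 1) 1 (2 * s) (N + s) k)
        sums ((N + 1) * hyp_Q s (N + 1) - (N + s) * hyp_Q s N)"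
    by (intro sums_diff sums_mult Q1 sums_hyp_Q s N)
  moreover have "(N + 1) * poch_ratio (s - 1) s (s + 1) 1 (2 * s) (N + 1 + s) k
          - (N + s) * poch_ratio (s - 1) s (s + 1) 1 (2 * s) (N + s) k
        = (1 - s) * poch_ratio s s (s + 1) 1 (2 * s) (N + 1 + s) k" for k
  proof -
    define p q r where "p = pochhammer (N + s) k" and "q = pochhammer (N + 1 + s) k"
      and "r = pochhammer s k * pochhammer (s + 1) k / (pochhammer 1 k * pochhammer (2 * s) k)"
    have nz: "p \<noteq> 0" "q \<noteq> 0"
      unfolding p_def q_def using s N
      by (auto intro!: pochhammer_neq_0_of_not_nonpos_Ints Re_pos_not_nonpos_Ints)
    have pq: "(N + s + of_nat k) * p = (N + s) * q"
      using pochhammer_rec[of "N + s" k] pochhammer_rec'[of "N + s" k]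
      by (simp add: p_def q_def ac_simps)
    have "(s - 1 + of_nat k) * pochhammer (s - 1) k = (s - 1) * pochhammer s k"
      using pochhammer_rec[of "s - 1" k] pochhammer_rec'[of "s - 1" k] by simp
    then have "(1 - s) * pochhammer s k = - ((s - 1 + of_nat k) * pochhammer (s - 1) k)"
      by (simp add: algebra_simps)
    then have "(1 - s) * (pochhammer s k * r / q) = - ((s - 1 + of_nat k) * pochhammer (s - 1) k) * r / q"
      by (metis mult.assoc times_divide_eq_right)
    moreover have "(N + s) / p = (N + s + of_nat k) / q"
      using pq nz by (simp add: field_simps)
    then have "(N + s) * (pochhammer (s - 1) k * r / p)
        = (N + s + of_nat k) * (pochhammer (s - 1) k * r / q)"
      by (metis times_divide_eq_left times_divide_eq_right mult.commute)
    then have "(N + 1) * (pochhammer (s - 1) k * r / q) - (N + s) * (pochhammer (s - 1) k * r / p)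
       = (N + 1 - (N + s + of_nat k)) * (pochhammer (s - 1) k * r / q)"
      by (simp only: left_diff_distrib)
    then have "(N + 1) * (pochhammer (s - 1) k * r / q) - (N + s) * (pochhammer (s - 1) k * r / p)
       = - ((s - 1 + of_nat k) * pochhammer (s - 1) k) * r / q"
      by (simp add: algebra_simps)
    ultimately have "(N + 1) * (pochhammer (s - 1) k * r / q) - (N + s) * (pochhammer (s - 1) k * r / p)
       = (1 - s) * (pochhammer s k * r / q)" by simp
    then show ?thesis by (simp add: poch_ratio_def p_def q_def r_def ac_simps)
  qed
  ultimately have "(\<lambda>k. (1 - s) * poch_ratio s s (s + 1) 1 (2 * s) (N + 1 + s) k)
      sums ((N + 1) * hyp_Q s (N + 1) - (N + s) * hyp_Q s N)" by simp
  then show ?thesis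
    using sums_unique2[OF _ sums_mult[OF sums_hyp_P[OF s(1) N], of "1 - s"]] by blast
qed

text \<open>Unlike \<open>hyp_Q_diff\<close> this fails term by term; the two sides differ by a
  telescoping sum, as in creative telescoping.\<close>

lemma hyp_P_diff:
  assumes s: "Re s > 0" "s \<noteq> 1" and N: "Re N > 0"
  shows "N * ((N + 1) * hyp_P s (N + 1) / (N + 1 + s) - hyp_P s N) = - s * hyp_Q s (N + 1)"
proof -
  define m where "m = N + 1 + s"
  define c where "c = (\<lambda>k. poch_ratio s s (s + 1) 1 (2 * s) m k)"
  define d where "d = (\<lambda>k. poch_ratio (s - 1) s (s + 1) 1 (2 * s) m k)"
  \<comment> \<open>The certificate: a rational multiple of the summand that vanishes at
    \<open>k = 0\<close> and tends to 0, because \<open>c k\<close> decays faster than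
    \<open>1 / k\<close>.\<close>
  define \<tau> where "\<tau> = (\<lambda>k. of_nat k * (2 * s + of_nat k - 1) / (s + of_nat k - 1) * c k)"
  have P1: "poch_ratio s s (s + 1) 1 (2 * s) (m + 1) sums hyp_P s (N + 1)"
    using sums_hyp_P[of s "N + 1"] s N by (simp add: m_def ac_simps)
  have Q1: "d sums hyp_Q s (N + 1)"
    using sums_hyp_Q[of s "N + 1"] s N by (simp add: d_def m_def ac_simps)
  have P0: "c sums hyp_P s N"
    using sums_hyp_P[of s N] s N by (simp add: c_def m_def ac_simps)
  have sk: "s + of_nat k - 1 \<noteq> 0" for k
  proof
    assume "s + of_nat k - 1 = 0"
    then have "Re s + real k - 1 = 0" and h: "s - 1 = - of_nat k" by (auto simp: complex_eq_iff)
    with s(1) have "k = 0" by linarith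
    with h s(2) show False by simp
  qed
  have mk: "m + of_nat k \<noteq> 0" for k using of_nat_add_neq_0[of m k] s N by (simp add: m_def)
  have "(\<lambda>k. N * ((N + 1) / m * poch_ratio s s (s + 1) 1 (2 * s) (m + 1) k - c k) + s * d k)
      sums (N * ((N + 1) / m * hyp_P s (N + 1) - hyp_P s N) + s * hyp_Q s (N + 1))"
    by (intro sums_add sums_mult sums_diff P1 P0 Q1)
  moreover have "N * ((N + 1) / m * poch_ratio s s (s + 1) 1 (2 * s) (m + 1) k - c k) + s * d k
      = \<tau> (Suc k) - \<tau> k" for k
  proof -
    define u where "u = c k"
    have dk: "d k = (s - 1) / (s + of_nat k - 1) * u"
    proof -
      have "(s - 1 + of_nat k) * pochhammer (s - 1) k = (s - 1) * pochhammer s k"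
        using pochhammer_rec[of "s - 1" k] pochhammer_rec'[of "s - 1" k] by simp
      then have "pochhammer (s - 1) k = (s - 1) / (s + of_nat k - 1) * pochhammer s k"
        using sk[of k] by (simp add: field_simps)
      then show ?thesis by (simp add: u_def d_def c_def poch_ratio_def)
    qed
    have p1: "poch_ratio s s (s + 1) 1 (2 * s) (m + 1) k = m / (m + of_nat k) * u"
    proof -
      have "m * pochhammer (m + 1) k = (m + of_nat k) * pochhammer m k"
        using pochhammer_rec[of m k] pochhammer_rec'[of m k] by simp
      then have "pochhammer (m + 1) k = (m + of_nat k) / m * pochhammer m k"
        using mk[of 0] by (simp add: field_simps)
      then show ?thesis by (simp add: u_def c_def poch_ratio_def ac_simps)
    qed
    have sk1: "s + of_nat k \<noteq> 0" using sk[of "Suc k"] by simp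
    have s2k: "2 * s + of_nat k \<noteq> 0" using of_nat_add_neq_0[of "2 * s" k] s by simp
    have k1: "1 + of_nat k \<noteq> (0::complex)" by (metis of_nat_Suc of_nat_neq_0)
    have cS: "c (Suc k) = (s + of_nat k) * (s + of_nat k) * (s + 1 + of_nat k)
        / ((1 + of_nat k) * (2 * s + of_nat k) * (m + of_nat k)) * u"
      by (simp add: u_def c_def poch_ratio_def pochhammer_rec' ac_simps)
    have tS: "\<tau> (Suc k) = (s + of_nat k) * (s + 1 + of_nat k) / (m + of_nat k) * u"
      using sk1 s2k k1 mk[of k] unfolding \<tau>_def cS by (simp add: divide_simps)
    have t0: "\<tau> k = of_nat k * (2 * s + of_nat k - 1) / (s + of_nat k - 1) * u"
      by (simp add: \<tau>_def u_def)
    define x y z where "x = s + of_nat k - 1" and "y = m + of_nat k" and "z = (of_nat k :: complex)"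
    have "x \<noteq> 0" "y \<noteq> 0" using sk mk by (auto simp: x_def y_def)
    have mm: "m \<noteq> 0" using mk[of 0] by simp
    have sx: "s = x - z + 1" and my: "m = y - z" by (simp_all add: x_def y_def z_def)
    have Ny: "N = m - 1 - s" by (simp add: m_def)
    have "N * ((N + 1) / m * (m / y * u) - u) + s * ((s - 1) / x * u)
       = (s + z) * (s + 1 + z) / y * u - z * (2 * s + z - 1) / x * u"
    proof -
      have "N * ((N + 1) / m * (m / y * u) - u) + s * ((s - 1) / x * u)
         = (N * (N + 1 - y) * x + s * (s - 1) * y) / (x * y) * u"
        using \<open>x \<noteq> 0\<close> \<open>y \<noteq> 0\<close> mm by (simp add: field_simps)
      \<comment> \<open>With the denominators cleared, the certificate identity is polynomial in
        \<open>x\<close>, \<open>y\<close> and \<open>z\<close>.\<close>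
      also have "N * (N + 1 - y) * x + s * (s - 1) * y
          = (s + z) * (s + 1 + z) * x - z * (2 * s + z - 1) * y"
        unfolding Ny my sx by algebra
      also have "((s + z) * (s + 1 + z) * x - z * (2 * s + z - 1) * y) / (x * y) * u
         = (s + z) * (s + 1 + z) / y * u - z * (2 * s + z - 1) / x * u"
        using \<open>x \<noteq> 0\<close> \<open>y \<noteq> 0\<close> by (simp add: field_simps)
      finally show ?thesis .
    qed
    then show ?thesis unfolding tS t0 dk p1 u_def[symmetric] x_def y_def z_def .
  qed
  ultimately have S: "(\<lambda>k. \<tau> (Suc k) - \<tau> k)
      sums (N * ((N + 1) / m * hyp_P s (N + 1) - hyp_P s N) + s * hyp_Q s (N + 1))" by simp
  have "\<tau> \<longlonglongrightarrow> 0"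
  proof -
    have 1: "(\<lambda>k. of_nat k * c k) \<longlonglongrightarrow> 0"
      unfolding c_def m_def using s N
      by (intro poch_ratio_times_index_tendsto_0 Re_pos_not_nonpos_Ints) auto
    have "(\<lambda>k. 1 + s / (of_nat k + (s - 1))) \<longlonglongrightarrow> 1 + 0"
      by (intro tendsto_add tendsto_const tendsto_divide_0[OF tendsto_const]
            tendsto_add_filterlim_at_infinity'[where c = "s - 1"] tendsto_of_nat)
    from tendsto_mult[OF this 1]
    have "(\<lambda>k. (1 + s / (of_nat k + (s - 1))) * (of_nat k * c k)) \<longlonglongrightarrow> 0" by simp
    moreover have "(1 + s / (of_nat k + (s - 1))) * (of_nat k * c k) = \<tau> k" for k
    proof -
      have e: "of_nat k + (s - 1) = s + of_nat k - 1" by simp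
      have "1 + s / (s + of_nat k - 1) = (2 * s + of_nat k - 1) / (s + of_nat k - 1)"
        using sk[of k] by (simp add: field_simps)
      then show ?thesis unfolding e \<tau>_def by simp
    qed
    ultimately show ?thesis by simp
  qed
  from telescope_sums[OF this] have "(\<lambda>k. \<tau> (Suc k) - \<tau> k) sums 0" by (simp add: \<tau>_def)
  with S have "N * ((N + 1) / m * hyp_P s (N + 1) - hyp_P s N) + s * hyp_Q s (N + 1) = 0"
    using sums_unique2 by blast
  then show ?thesis by (simp add: m_def add_eq_0_iff)
qed

subsection \<open>The recessive solution\<close>

text \<open>Up to a constant factor, \<open>gfac s v n\<close> is \<open>Gamma (n + v + 1) / Gamma (n + v + 1 + s)\<close>.\<close>

definition gfac :: "complex \<Rightarrow> complex \<Rightarrow> nat \<Rightarrow> complex" where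
  "gfac s v n = pochhammer (v + 1) n / pochhammer (v + 1 + s) n"

text \<open>The step ratio of \<open>gfac\<close> is the factor \<open>(N + 1) / (N + 1 + s)\<close>
  of \<open>hyp_P_diff\<close>; multiplying by it turns both contiguous relations into first
  differences.\<close>

definition phi :: "complex \<Rightarrow> complex \<Rightarrow> nat \<Rightarrow> complex" where
  "phi s v n = gfac s v n * hyp_P s (v + of_nat n)"

definition psi :: "complex \<Rightarrow> complex \<Rightarrow> nat \<Rightarrow> complex" where
  "psi s v n = gfac s v n * (v + of_nat n + s) * hyp_Q s (v + of_nat n)"

lemma gfac_Suc: "gfac s v (Suc n) = gfac s v n * ((v + of_nat n + 1) / (v + of_nat n + 1 + s))"
  by (simp add: gfac_def pochhammer_rec' ac_simps)

lemma psi_diff: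
  assumes s: "Re s > 0" "s \<noteq> 1" and v: "Re v > 0"
  shows "psi s v (Suc n) - psi s v n = (1 - s) * phi s v n"
proof -
  define N where "N = v + of_nat n"
  have N: "Re N > 0" using v by (simp add: N_def)
  have nz: "N + 1 + s \<noteq> 0" using N s by (auto simp: complex_eq_iff)
  have "psi s v (Suc n) = gfac s v n * ((N + 1) / (N + 1 + s)) * (N + 1 + s) * hyp_Q s (N + 1)"
    by (simp add: psi_def gfac_Suc N_def add.assoc add.commute add.left_commute)
  also have "\<dots> = gfac s v n * ((N + 1) * hyp_Q s (N + 1))" using nz by simp
  finally have "psi s v (Suc n) - psi s v n
      = gfac s v n * ((N + 1) * hyp_Q s (N + 1) - (N + s) * hyp_Q s N)"
    by (simp add: psi_def N_def right_diff_distrib mult.assoc)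
  then show ?thesis using hyp_Q_diff[OF s N] by (simp add: phi_def N_def)
qed

text \<open>With \<open>psi_diff\<close> this is the eigenvalue equation as a first-order system:
  for \<open>v = \<nu>\<close> the coefficient on the left is \<open>jacobi_b \<nu> n\<close>, so
  \<open>psi\<close> is the flux up to a factor.\<close>

lemma phi_diff:
  assumes s: "Re s > 0" "s \<noteq> 1" and v: "Re v > 0"
  shows "(v + of_nat n) * (v + of_nat n + 1) * (phi s v (Suc n) - phi s v n) = - s * psi s v (Suc n)"
proof -
  define N where "N = v + of_nat n"
  have N: "Re N > 0" using v by (simp add: N_def)
  have nz: "N + 1 + s \<noteq> 0" using N s by (auto simp: complex_eq_iff)
  have "psi s v (Suc n) = gfac s v n * ((N + 1) / (N + 1 + s)) * (N + 1 + s) * hyp_Q s (N + 1)"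
    by (simp add: psi_def gfac_Suc N_def add.assoc add.commute add.left_commute)
  also have "\<dots> = gfac s v n * ((N + 1) * hyp_Q s (N + 1))" using nz by simp
  finally have psi: "psi s v (Suc n) = gfac s v n * ((N + 1) * hyp_Q s (N + 1))" .
  have "phi s v (Suc n) = gfac s v n * ((N + 1) / (N + 1 + s)) * hyp_P s (N + 1)"
    by (simp add: phi_def gfac_Suc N_def add.assoc add.commute add.left_commute)
  then have "N * (N + 1) * (phi s v (Suc n) - phi s v n)
      = gfac s v n * (N + 1) * (N * ((N + 1) * hyp_P s (N + 1) / (N + 1 + s) - hyp_P s N))"
    by (simp add: phi_def N_def algebra_simps)
  also have "\<dots> = - s * psi s v (Suc n)"
    unfolding hyp_P_diff[OF s N] psi by simp
  finally show ?thesis by (simp add: N_def)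
qed

lemma psi_eq_sum:
  assumes "Re s > 0" "s \<noteq> 1" and "Re v > 0"
  shows "psi s v (Suc n) = psi s v 0 + (1 - s) * (\<Sum>k\<le>n. phi s v k)"
proof (induction n)
  case 0
  show ?case using psi_diff[OF assms, of 0] by (simp add: algebra_simps)
next
  case (Suc n)
  show ?case using psi_diff[OF assms, of "Suc n"] Suc by (simp add: algebra_simps)
qed

section \<open>Decay of the recessive solution\<close>

lemma norm_le_norm_add_of_nat:
  assumes "Re z \<ge> 0"
  shows "norm z \<le> norm (z + of_nat n)"
  unfolding cmod_def using assms by (intro real_sqrt_le_mono add_mono power_mono[of "Re z"]) auto

lemma norm_pochhammer_le_add_of_nat:
  assumes "Re z \<ge> 0"
  shows "norm (pochhammer z k) \<le> norm (pochhammer (z + of_nat n) k)"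
proof (induction k)
  case (Suc k)
  have "norm (z + of_nat k) \<le> norm (z + of_nat n + of_nat k)"
    using norm_le_norm_add_of_nat[of "z + of_nat k" n] assms by (simp add: ac_simps)
  with Suc show ?case by (simp add: pochhammer_rec' norm_mult mult_mono)
qed simp

text \<open>Only the first term survives: in each later one the leading factor of
  \<open>pochhammer (M + of_nat n) (Suc k)\<close> gains \<open>norm M / norm (M + of_nat n)\<close>
  over the term at \<open>n = 0\<close>, and the remaining factors do not decrease in
  modulus.\<close>

lemma hyp_P_tendsto_1:
  assumes s: "Re s > 0" and v: "Re v > 0"
  shows "(\<lambda>n. hyp_P s (v + of_nat n)) \<longlonglongrightarrow> 1"
proof -
  define M where "M = v + 1 + s"
  have M: "Re M > 0" using s v by (simp add: M_def)
  let ?T = "\<lambda>n. poch_ratio s s (s + 1) 1 (2 * s) (M + of_nat n)"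
  define K where "K = (\<Sum>k. norm (?T 0 (Suc k)))"
  have sm0: "summable (\<lambda>k. norm (?T 0 (Suc k)))"
    using summable_hyp_P[OF s v] by (subst summable_Suc_iff) (simp add: M_def)
  have bd: "norm (hyp_P s (v + of_nat n) - 1) \<le> norm M / norm (M + of_nat n) * K" for n
  proof -
    have nz: "M + of_nat n \<noteq> 0" "M \<noteq> 0"
      using of_nat_add_neq_0[OF M, of n] of_nat_add_neq_0[OF M, of 0] by auto
    have 1: "norm (?T n (Suc k)) \<le> norm M / norm (M + of_nat n) * norm (?T 0 (Suc k))" for k
    proof -
      let ?A = "norm (pochhammer s (Suc k) * pochhammer s (Suc k) * pochhammer (s + 1) (Suc k)
                   / (pochhammer 1 (Suc k) * pochhammer (2 * s) (Suc k)))"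
      let ?p = "norm (pochhammer (M + 1) k)" and ?q = "norm (pochhammer (M + 1 + of_nat n) k)"
      have p: "?p > 0"
        using pochhammer_neq_0_of_not_nonpos_Ints[OF Re_pos_not_nonpos_Ints, of "M + 1" k] M by simp
      have q: "?p \<le> ?q"
        using norm_pochhammer_le_add_of_nat[of "M + 1" k n] M by (simp add: ac_simps)
      have "norm (?T n (Suc k)) = ?A / norm (M + of_nat n) / ?q"
        by (simp add: poch_ratio_def pochhammer_rec[of "M + of_nat n"] norm_mult norm_divide ac_simps)
      also have "\<dots> \<le> ?A / norm (M + of_nat n) / ?p"
        using p q by (intro divide_left_mono mult_pos_pos) auto
      also have "\<dots> = norm M / norm (M + of_nat n) * (?A / norm M / ?p)"
        using nz by simp
      also have "?A / norm M / ?p = norm (?T 0 (Suc k))"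
        by (simp add: poch_ratio_def pochhammer_rec[of "M"] norm_mult norm_divide ac_simps)
      finally show ?thesis .
    qed
    have "?T n sums hyp_P s (v + of_nat n)"
      using sums_hyp_P[of s "v + of_nat n"] s v by (simp add: M_def ac_simps)
    then have "(\<lambda>k. ?T n (Suc k)) sums (hyp_P s (v + of_nat n) - 1)"
      by (subst sums_Suc_iff) simp
    moreover have sm: "summable (\<lambda>k. norm (?T n (Suc k)))"
      by (rule summable_comparison_test'[OF summable_mult[OF sm0, of "norm M / norm (M + of_nat n)"],
            of 0]) (simp only: real_norm_def abs_norm_cancel 1)
    ultimately have "norm (hyp_P s (v + of_nat n) - 1) \<le> (\<Sum>k. norm (?T n (Suc k)))"
      using summable_norm[OF sm] sums_unique by metis
    also have "\<dots> \<le> (\<Sum>k. norm M / norm (M + of_nat n) * norm (?T 0 (Suc k)))"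
      by (intro suminf_le 1 sm summable_mult sm0)
    also have "\<dots> = norm M / norm (M + of_nat n) * K"
      unfolding K_def by (rule suminf_mult[OF sm0])
    finally show ?thesis .
  qed
  have "(\<lambda>n. M / (M + of_nat n)) \<longlonglongrightarrow> 0"
    by (intro tendsto_divide_0[OF tendsto_const] tendsto_add_filterlim_at_infinity[where c = M]
          tendsto_of_nat tendsto_const)
  then have "(\<lambda>n. norm M / norm (M + of_nat n)) \<longlonglongrightarrow> 0"
    using tendsto_norm by (fastforce simp: norm_divide)
  then have "(\<lambda>n. norm M / norm (M + of_nat n) * K) \<longlonglongrightarrow> 0"
    by (rule tendsto_mult_left_zero)
  then have "(\<lambda>n. hyp_P s (v + of_nat n) - 1) \<longlonglongrightarrow> 0"
    by (rule Lim_null_comparison[rotated]) (use bd in auto)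
  then show ?thesis by (simp add: LIM_zero_iff)
qed

text \<open>The power comes from \<open>gfac\<close> alone, as \<open>hyp_P\<close> tends to 1.
  Positivity of the limit is what later shows that \<open>phi\<close> is nonzero and, for
  \<open>Re s = 1/2\<close>, not square summable.\<close>

lemma phi_asymp:
  assumes s: "Re s > 0" and v: "Re v > 0"
  obtains C where "C > 0" "(\<lambda>n. norm (phi s v n) * real n powr Re s) \<longlonglongrightarrow> C"
proof -
  let ?C = "Gamma (v + 1 + s) / Gamma (v + 1)"
  have np: "v + 1 \<notin> \<int>\<^sub>\<le>\<^sub>0" "v + 1 + s \<notin> \<int>\<^sub>\<le>\<^sub>0"
    using s v by (auto intro!: Re_pos_not_nonpos_Ints)
  have "(\<lambda>n. pochhammer (v + 1) n / pochhammer (v + 1 + s) n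
          * exp ((v + 1 + s - (v + 1)) * of_real (ln (real n))) * hyp_P s (v + of_nat n))
        \<longlonglongrightarrow> ?C * 1"
    by (intro tendsto_mult pochhammer_ratio_asymp np hyp_P_tendsto_1 s v)
  then have "(\<lambda>n. norm (phi s v n * exp (s * of_real (ln (real n))))) \<longlonglongrightarrow> norm ?C"
    unfolding phi_def gfac_def by (intro tendsto_norm) (simp add: ac_simps)
  then have "(\<lambda>n. norm (phi s v n) * real n powr Re s) \<longlonglongrightarrow> norm ?C"
    by (rule Lim_transform_eventually)
       (use norm_exp_times_ln in \<open>auto simp: norm_mult intro!: eventually_sequentiallyI[of 1]\<close>)
  moreover have "norm ?C > 0" using np by (simp add: Gamma_eq_zero_iff)
  ultimately show thesis using that by blast
qed

lemma Bseq_sqrt_phi: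
  assumes s: "Re s \<ge> 1/2" and v: "Re v > 0"
  shows "Bseq (\<lambda>n. sqrt (real n + 1) * norm (phi s v n))"
proof -
  obtain C where "(\<lambda>n. norm (phi s v n) * real n powr Re s) \<longlonglongrightarrow> C"
    using phi_asymp[of s v] s v by auto
  then have B: "Bseq (\<lambda>n. sqrt 2 * (norm (phi s v n) * real n powr Re s))"
    using convergent_imp_Bseq convergentI tendsto_mult_left by blast
  have "norm (sqrt (real n + 1) * norm (phi s v n))
      \<le> norm (sqrt 2 * (norm (phi s v n) * real n powr Re s))" if "n \<ge> 1" for n
  proof -
    have "sqrt (real n + 1) \<le> sqrt (2 * real n)" using that by simp
    also have "\<dots> = sqrt 2 * real n powr (1/2)" by (simp add: real_sqrt_mult powr_half_sqrt)
    also have "\<dots> \<le> sqrt 2 * real n powr Re s"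
      using that s by (intro mult_left_mono powr_mono) auto
    finally have "sqrt (real n + 1) * norm (phi s v n)
        \<le> (sqrt 2 * real n powr Re s) * norm (phi s v n)" by (intro mult_right_mono) auto
    then show ?thesis by (simp add: abs_mult mult_ac)
  qed
  then have "\<forall>\<^sub>F n in sequentially. norm (sqrt (real n + 1) * norm (phi s v n))
      \<le> norm (sqrt 2 * (norm (phi s v n) * real n powr Re s))"
    by (rule eventually_sequentiallyI)
  with B show ?thesis using Bseq_eventually_mono by fast
qed

lemma sqrt_phi_tendsto_0:
  assumes s: "Re s > 1/2" and v: "Re v > 0"
  shows "(\<lambda>n. sqrt (real n + 1) * norm (phi s v n)) \<longlonglongrightarrow> 0"
proof -
  obtain C where C: "(\<lambda>n. norm (phi s v n) * real n powr Re s) \<longlonglongrightarrow> C"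
    using phi_asymp[of s v] s v by auto
  have "(\<lambda>n. real n powr (1/2 - Re s)) \<longlonglongrightarrow> 0"
    using s by (intro tendsto_neg_powr filterlim_real_sequentially) auto
  from tendsto_mult[OF tendsto_const tendsto_mult[OF this C], of "sqrt 2"]
  have "(\<lambda>n. sqrt 2 * (real n powr (1/2 - Re s) * (norm (phi s v n) * real n powr Re s))) \<longlonglongrightarrow> 0"
    by simp
  then show ?thesis
  proof (rule Lim_null_comparison[OF eventually_sequentiallyI[of 1], rotated])
    fix n :: nat assume n: "1 \<le> n"
    have "sqrt (real n + 1) \<le> sqrt (2 * real n)" using n by simp
    also have "\<dots> = sqrt 2 * real n powr (1/2)" by (simp add: real_sqrt_mult powr_half_sqrt)
    finally have "sqrt (real n + 1) * norm (phi s v n)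
        \<le> (sqrt 2 * real n powr (1/2)) * norm (phi s v n)" by (intro mult_right_mono) auto
    also have "real n powr (1/2) = real n powr (1/2 - Re s) * real n powr Re s"
      by (simp flip: powr_add)
    finally show "norm (sqrt (real n + 1) * norm (phi s v n))
      \<le> sqrt 2 * (real n powr (1/2 - Re s) * (norm (phi s v n) * real n powr Re s))"
      by (simp add: abs_mult mult_ac)
  qed
qed

lemma Bseq_phi_powr:
  assumes s: "Re s > 0" and v: "Re v > 0"
  obtains K where "K > 0" "\<And>n. n \<ge> 1 \<Longrightarrow> norm (phi s v n) \<le> K * real n powr (- Re s)"
proof -
  obtain C where "(\<lambda>n. norm (phi s v n) * real n powr Re s) \<longlonglongrightarrow> C"
    using phi_asymp[of s v] s v by auto
  then have "Bseq (\<lambda>n. norm (phi s v n) * real n powr Re s)"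
    using convergent_imp_Bseq convergentI by blast
  then obtain K where K: "K > 0" "\<And>n. norm (norm (phi s v n) * real n powr Re s) \<le> K"
    by (auto simp: Bseq_def)
  have "norm (phi s v n) \<le> K * real n powr (- Re s)" if "n \<ge> 1" for n
    using K(2)[of n] that by (simp add: powr_minus field_simps)
  with K(1) show thesis using that by blast
qed

lemma summable_phi_mult_phi:
  assumes s: "Re s1 > 0" "Re s2 > 0" "Re s1 + Re s2 > 1" and v: "Re v1 > 0" "Re v2 > 0"
  shows "summable (\<lambda>n. norm (phi s1 v1 n) * norm (phi s2 v2 n))"
proof -
  obtain K1 where K1: "K1 > 0" "\<And>n. n \<ge> 1 \<Longrightarrow> norm (phi s1 v1 n) \<le> K1 * real n powr (- Re s1)"
    using Bseq_phi_powr[OF s(1) v(1)] by blast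
  obtain K2 where K2: "K2 > 0" "\<And>n. n \<ge> 1 \<Longrightarrow> norm (phi s2 v2 n) \<le> K2 * real n powr (- Re s2)"
    using Bseq_phi_powr[OF s(2) v(2)] by blast
  have sm: "summable (\<lambda>n. K1 * K2 * real n powr (- (Re s1 + Re s2)))"
    using s by (intro summable_mult) (simp add: summable_real_powr_iff)
  have le: "norm (norm (phi s1 v1 n) * norm (phi s2 v2 n)) \<le> K1 * K2 * real n powr (- (Re s1 + Re s2))"
    if n: "n \<ge> 1" for n
  proof -
    have "norm (phi s1 v1 n) * norm (phi s2 v2 n)
        \<le> (K1 * real n powr (- Re s1)) * (K2 * real n powr (- Re s2))"
      using K1 K2 n by (intro mult_mono) auto
    also have "\<dots> = K1 * K2 * real n powr (- (Re s1 + Re s2))"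
      by (simp add: mult_ac flip: powr_add)
    finally show ?thesis by (simp add: abs_mult)
  qed
  show ?thesis by (rule summable_comparison_test'[OF sm le])
qed

lemma phi_in_ell2:
  assumes s: "Re s > 1/2" and v: "Re v > 0"
  shows "phi s v \<in> ell2"
  using summable_phi_mult_phi[of s s v v] s v by (simp add: ell2_def power2_eq_square)

text \<open>The squared moduli eventually dominate a positive multiple of the harmonic
  series.\<close>

lemma phi_not_in_ell2:
  assumes s: "Re s = 1/2" and v: "Re v > 0"
  shows "phi s v \<notin> ell2"
proof
  assume "phi s v \<in> ell2"
  then have sm: "summable (\<lambda>n. (norm (phi s v n))\<^sup>2)" by (simp add: ell2_def)
  obtain C where C: "C > 0" "(\<lambda>n. norm (phi s v n) * real n powr Re s) \<longlonglongrightarrow> C"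
    using phi_asymp[of s v] s v by auto
  then have "eventually (\<lambda>n. norm (phi s v n) * real n powr Re s > C / 2) sequentially"
    by (intro order_tendstoD) auto
  then have "eventually (\<lambda>n. norm (real n powr (- 1)) \<le> (2 / C)\<^sup>2 * (norm (phi s v n))\<^sup>2) sequentially"
    using eventually_gt_at_top[of 0]
  proof eventually_elim
    case (elim n)
    have "(C / 2)\<^sup>2 \<le> (norm (phi s v n) * real n powr (1/2))\<^sup>2"
      using elim C s by (intro power_mono) auto
    also have "\<dots> = (norm (phi s v n))\<^sup>2 * real n"
      using elim by (simp add: power_mult_distrib power2_eq_square flip: powr_add)
    finally show ?case using elim C
      by (simp add: powr_minus field_simps power2_eq_square)
  qed
  from summable_comparison_test_ev[OF this summable_mult[OF sm]]
  have "summable (\<lambda>n. real n powr (- 1))" .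
  then show False by (simp only: summable_real_powr_iff)
qed

subsection \<open>Eigenvectors\<close>

text \<open>The eigenvalue equation summed over the first \<open>n + 1\<close> rows.\<close>

definition jacobi_flux :: "real \<Rightarrow> complex \<Rightarrow> (nat \<Rightarrow> complex) \<Rightarrow> bool" where
  "jacobi_flux \<nu> z x \<longleftrightarrow> (\<forall>n. of_real (jacobi_b \<nu> n) * (x (Suc n) - x n) = - z * (\<Sum>k\<le>n. x k))"

lemma jacobi_op_0: "jacobi_op \<nu> x 0 = of_real (jacobi_b \<nu> 0) * (x 0 - x 1)"
proof -
  have "jacobi_op \<nu> x 0 = (\<Sum>n\<in>{0,1}. of_real (jacobi_matrix \<nu> 0 n) * x n)"
    unfolding jacobi_op_def by (rule suminf_finite) (auto simp: jacobi_matrix_def)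
  then show ?thesis by (simp add: jacobi_matrix_def algebra_simps)
qed

lemma jacobi_op_Suc:
  "jacobi_op \<nu> x (Suc m) = of_real (jacobi_b \<nu> m) * (x (Suc m) - x m)
     - of_real (jacobi_b \<nu> (Suc m)) * (x (Suc (Suc m)) - x (Suc m))"
proof -
  have "jacobi_op \<nu> x (Suc m)
      = (\<Sum>n\<in>{m, Suc m, Suc (Suc m)}. of_real (jacobi_matrix \<nu> (Suc m) n) * x n)"
    unfolding jacobi_op_def by (rule suminf_finite) (auto simp: jacobi_matrix_def)
  then show ?thesis by (simp add: jacobi_matrix_def algebra_simps)
qed

text \<open>Row n + 1 is a difference of consecutive fluxes, and the corner entry
  \<open>jacobi_b \<nu> 0\<close> says that no flux enters from the left; hence partial sums of the
  rows telescope.\<close>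

lemma jacobi_op_eq_iff_flux: "jacobi_op \<nu> x = (\<lambda>n. z * x n) \<longleftrightarrow> jacobi_flux \<nu> z x"
proof
  assume J: "jacobi_op \<nu> x = (\<lambda>n. z * x n)"
  show "jacobi_flux \<nu> z x" unfolding jacobi_flux_def
  proof
    fix n show "of_real (jacobi_b \<nu> n) * (x (Suc n) - x n) = - z * (\<Sum>k\<le>n. x k)"
    proof (induction n)
      case 0
      show ?case using jacobi_op_0[of \<nu> x] J by (simp add: algebra_simps)
    next
      case (Suc n)
      have "z * x (Suc n) = jacobi_op \<nu> x (Suc n)" using J by simp
      then have "of_real (jacobi_b \<nu> (Suc n)) * (x (Suc (Suc n)) - x (Suc n))
          = of_real (jacobi_b \<nu> n) * (x (Suc n) - x n) - z * x (Suc n)"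
        unfolding jacobi_op_Suc by (simp add: algebra_simps)
      also have "\<dots> = - z * (\<Sum>k\<le>Suc n. x k)" unfolding Suc by (simp add: algebra_simps)
      finally show ?case .
    qed
  qed
next
  assume F: "jacobi_flux \<nu> z x"
  show "jacobi_op \<nu> x = (\<lambda>n. z * x n)"
  proof
    fix n show "jacobi_op \<nu> x n = z * x n"
    proof (cases n)
      case 0
      have "jacobi_op \<nu> x 0 = - (of_real (jacobi_b \<nu> 0) * (x (Suc 0) - x 0))"
        unfolding jacobi_op_0 by (simp add: algebra_simps)
      then show ?thesis
        unfolding F[unfolded jacobi_flux_def, rule_format, of 0] 0 by simp
    next
      case (Suc m)
      show ?thesis
        unfolding Suc jacobi_op_Suc F[unfolded jacobi_flux_def, rule_format]
        by (simp add: algebra_simps)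
    qed
  qed
qed

lemma ell2_mult: "x \<in> ell2 \<Longrightarrow> (\<lambda>n. z * x n) \<in> ell2"
  by (simp add: ell2_def norm_mult power_mult_distrib summable_mult)

text \<open>The domain condition is automatic for an eigenvector, whose image is a multiple of
  itself.\<close>

lemma point_spectrum_jacobi_iff:
  "z \<in> point_spectrum (jacobi_dom \<nu>) (jacobi_op \<nu>)
     \<longleftrightarrow> (\<exists>x\<in>ell2. x \<noteq> (\<lambda>n. 0) \<and> jacobi_flux \<nu> z x)"
  unfolding point_spectrum_def jacobi_dom_def
  using ell2_mult by (auto simp flip: jacobi_op_eq_iff_flux)

lemma of_real_jacobi_b:
  "of_real (jacobi_b \<nu> n) = (of_real \<nu> + of_nat n) * (of_real \<nu> + of_nat n + (1::complex))"
  by (simp add: jacobi_b_def algebra_simps)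

lemma jacobi_b_pos: "\<nu> > 0 \<Longrightarrow> jacobi_b \<nu> n > 0"
  by (simp add: jacobi_b_def add_nonneg_pos)

text \<open>\<open>phi\<close> satisfies the flux equation up to the constant
  \<open>- s * psi s \<nu> 0\<close>; the boundary condition is the vanishing of this
  constant.\<close>

lemma phi_flux:
  assumes "Re s > 0" "s \<noteq> 1" and "\<nu> > 0"
  shows "of_real (jacobi_b \<nu> n) * (phi s (of_real \<nu>) (Suc n) - phi s (of_real \<nu>) n)
     = - s * psi s (of_real \<nu>) 0 - s * (1 - s) * (\<Sum>k\<le>n. phi s (of_real \<nu>) k)"
  using phi_diff[of s "of_real \<nu>" n] psi_eq_sum[of s "of_real \<nu>" n] assms
  by (simp add: of_real_jacobi_b algebra_simps)

lemma jacobi_flux_phi: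
  assumes "Re s > 0" "s \<noteq> 1" and "\<nu> > 0" and "hyp_Q s (of_real \<nu>) = 0"
  shows "jacobi_flux \<nu> (s * (1 - s)) (phi s (of_real \<nu>))"
  using phi_flux[OF assms(1-3)] assms(4) by (simp add: jacobi_flux_def psi_def)

text \<open>The first-order recursion fixes a solution by its value at 0. Proportionality is
  cross-multiplied, so that neither initial value has to be nonzero.\<close>

lemma jacobi_flux_unique:
  assumes \<nu>: "\<nu> > 0" and x: "jacobi_flux \<nu> z x" and y: "jacobi_flux \<nu> z y"
  shows "x 0 * y n = y 0 * x n"
proof (induction n rule: less_induct)
  case (less n)
  show ?case
  proof (cases n)
    case (Suc m)
    let ?b = "complex_of_real (jacobi_b \<nu> m)"
    have b: "?b \<noteq> 0" using jacobi_b_pos[OF \<nu>] by (metis less_irrefl of_real_eq_0_iff)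
    have IH: "x 0 * y k = y 0 * x k" if "k \<le> m" for k using less.IH[of k] that Suc by simp
    have "x 0 * (?b * (y (Suc m) - y m)) = - z * (\<Sum>k\<le>m. x 0 * y k)"
      using y[unfolded jacobi_flux_def, rule_format, of m] by (simp add: sum_distrib_left mult_ac)
    also have "(\<Sum>k\<le>m. x 0 * y k) = (\<Sum>k\<le>m. y 0 * x k)"
      using IH by (intro sum.cong) auto
    also have "- z * \<dots> = y 0 * (?b * (x (Suc m) - x m))"
      using x[unfolded jacobi_flux_def, rule_format, of m] by (simp add: sum_distrib_left mult_ac)
    finally have "?b * (x 0 * y (Suc m) - x 0 * y m) = ?b * (y 0 * x (Suc m) - y 0 * x m)"
      by (simp add: algebra_simps)
    then show ?thesis using b IH[of m] Suc by simp
  qed simp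
qed

lemma jacobi_flux_nonzero_0:
  assumes \<nu>: "\<nu> > 0" and x: "jacobi_flux \<nu> z x" and "x \<noteq> (\<lambda>n. 0)"
  shows "x 0 \<noteq> 0"
proof
  assume x0: "x 0 = 0"
  have "x n = 0" for n
  proof (induction n rule: less_induct)
    case (less n)
    show ?case
    proof (cases n)
      case (Suc m)
      have "complex_of_real (jacobi_b \<nu> m) \<noteq> 0"
        using jacobi_b_pos[OF \<nu>] by (metis less_irrefl of_real_eq_0_iff)
      moreover have "complex_of_real (jacobi_b \<nu> m) * (x (Suc m) - x m) = - z * (\<Sum>k\<le>m. 0)"
        unfolding x[unfolded jacobi_flux_def, rule_format, of m] using less.IH Suc by simp
      ultimately show ?thesis using less.IH[of m] Suc by simp
    qed (use x0 in simp)
  qed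
  with assms(3) show False by auto
qed

subsection \<open>Square summable sequences\<close>

text \<open>Cauchy-Schwarz on the whole sum gives only boundedness; applied to a tail of small norm
  it gives the limit 0, as the fixed head \<open>A\<close> is outgrown by the square root.\<close>

lemma ell2_sum_sublinear:
  assumes "x \<in> ell2"
  shows "(\<lambda>n. (\<Sum>k\<le>n. norm (x k)) / sqrt (real n + 1)) \<longlonglongrightarrow> 0"
proof (rule LIMSEQ_I)
  fix \<epsilon> :: real assume \<epsilon>: "\<epsilon> > 0"
  have sm: "summable (\<lambda>n. (norm (x n))\<^sup>2)" using assms by (simp add: ell2_def)
  from summable_Cauchy[THEN iffD1, OF this, rule_format, of "(\<epsilon>/2)\<^sup>2"] \<epsilon>
  obtain M where M: "\<And>m n. m \<ge> M \<Longrightarrow> norm (\<Sum>k\<in>{m..<n}. (norm (x k))\<^sup>2) < (\<epsilon>/2)\<^sup>2" by auto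
  define A where "A = (\<Sum>k<M. norm (x k))"
  have "A \<ge> 0" by (auto simp: A_def sum_nonneg)
  obtain n0 :: nat where n0: "real n0 > (2 * A / \<epsilon>)\<^sup>2" using reals_Archimedean2 by blast
  have "norm ((\<Sum>k\<le>n. norm (x k)) / sqrt (real n + 1) - 0) < \<epsilon>" if n: "n \<ge> max M n0" for n
  proof -
    have "(\<Sum>k\<in>{M..<Suc n}. 1 * norm (x k))\<^sup>2
        \<le> (\<Sum>k\<in>{M..<Suc n}. 1\<^sup>2) * (\<Sum>k\<in>{M..<Suc n}. (norm (x k))\<^sup>2)"
      by (rule Cauchy_Schwarz_ineq_sum)
    also have "\<dots> \<le> (real n + 1) * (\<epsilon>/2)\<^sup>2"
      using M[of M "Suc n"] by (intro mult_mono) (auto simp: sum_nonneg simp del: sum.atLeastLessThan_Suc)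
    also have "\<dots> = (sqrt (real n + 1) * (\<epsilon>/2))\<^sup>2"
      by (simp only: power_mult_distrib real_sqrt_pow2_iff) simp
    finally have B: "(\<Sum>k\<in>{M..<Suc n}. norm (x k)) \<le> sqrt (real n + 1) * (\<epsilon>/2)"
      using \<epsilon> by (simp add: power2_le_iff_abs_le del: sum.atLeastLessThan_Suc)
    have "2 * A / \<epsilon> < sqrt (real n + 1)"
      using n0 n by (intro real_less_rsqrt) auto
    then have "A < sqrt (real n + 1) * (\<epsilon>/2)" using \<epsilon> by (simp add: field_simps)
    moreover have "(\<Sum>k\<le>n. norm (x k)) = A + (\<Sum>k\<in>{M..<Suc n}. norm (x k))"
      using n unfolding A_def lessThan_Suc_atMost[symmetric] atLeast0LessThan[symmetric]
      by (intro sum.atLeastLessThan_concat[symmetric]) auto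
    ultimately have "(\<Sum>k\<le>n. norm (x k)) < sqrt (real n + 1) * \<epsilon>" using B by simp
    moreover have "(\<Sum>k\<le>n. norm (x k)) \<ge> 0" by (auto intro: sum_nonneg)
    ultimately show ?thesis by (simp add: field_simps)
  qed
  then show "\<exists>no. \<forall>n\<ge>no. norm ((\<Sum>k\<le>n. norm (x k)) / sqrt (real n + 1) - 0) < \<epsilon>" by blast
qed

text \<open>Otherwise the squares would eventually dominate a multiple of the harmonic series.
  Without monotonicity of the moduli only a subsequence can be expected.\<close>

lemma ell2_subseq_sqrt:
  assumes "x \<in> ell2"
  obtains r :: "nat \<Rightarrow> nat" where "strict_mono r"
    "(\<lambda>j. sqrt (real (r j) + 1) * norm (x (r j))) \<longlonglongrightarrow> 0"
proof -
  let ?f = "\<lambda>n. sqrt (real n + 1) * norm (x n)"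
  have ex: "\<exists>n>m. ?f n < \<epsilon>" if \<epsilon>: "\<epsilon> > 0" for \<epsilon> m
  proof (rule ccontr)
    assume neg: "\<not> (\<exists>n>m. ?f n < \<epsilon>)"
    have le: "norm (inverse (real (Suc n))) \<le> (1 / \<epsilon>\<^sup>2) * (norm (x n))\<^sup>2" if "n \<ge> Suc m" for n
    proof -
      have "\<epsilon> \<le> ?f n" using neg that by (meson Suc_le_lessD not_less)
      then have "\<epsilon>\<^sup>2 \<le> (?f n)\<^sup>2" using \<epsilon> by (intro power_mono) auto
      also have "\<dots> = (real n + 1) * (norm (x n))\<^sup>2" by (simp add: power_mult_distrib)
      finally show ?thesis using \<epsilon> by (simp add: field_simps)
    qed
    have sm: "summable (\<lambda>n. (1 / \<epsilon>\<^sup>2) * (norm (x n))\<^sup>2)"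
      using assms by (intro summable_mult) (simp add: ell2_def)
    have "summable (\<lambda>n. inverse (real (Suc n)))"
      by (rule summable_comparison_test'[OF sm le])
    then have "summable (\<lambda>n. inverse (real n))"
      by (rule summable_Suc_iff[THEN iffD1])
    then show False using not_summable_harmonic by blast
  qed
  have "\<exists>r. \<forall>j. ?f (r j) < 1 / real (Suc j) \<and> r j < r (Suc j)"
  proof (rule dependent_nat_choice)
    show "\<exists>n. ?f n < 1 / real (Suc 0)" using ex[of 1 0] by auto
    fix n j show "\<exists>n'. ?f n' < 1 / real (Suc (Suc j)) \<and> n < n'"
      using ex[of "1 / real (Suc (Suc j))" n] by auto
  qed
  then obtain r where r: "\<And>j. ?f (r j) < 1 / real (Suc j)" "\<And>j. r j < r (Suc j)" by blast
  have "strict_mono r" using r(2) by (simp add: strict_mono_Suc_iff)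
  moreover have "(\<lambda>j. ?f (r j)) \<longlonglongrightarrow> 0"
    by (rule Lim_null_comparison[OF _ LIMSEQ_Suc[OF lim_1_over_n]])
       (use r(1) in \<open>auto intro!: always_eventually less_imp_le simp: abs_mult\<close>)
  ultimately show thesis using that by blast
qed

section \<open>Green identity and positivity of eigenvalues\<close>

text \<open>Summation by parts. The boundary term carries the partial sum instead of the flux, so it
  can be estimated without knowing the differences of \<open>x\<close>.\<close>

lemma green_flux:
  assumes "jacobi_flux \<nu> z x"
  shows "(\<Sum>k\<le>n. z * (x k * y k)) = (\<Sum>k<n. of_real (jacobi_b \<nu> k) * ((x (Suc k) - x k) * (y (Suc k) - y k)))
            + z * (\<Sum>k\<le>n. x k) * y n"
proof (induction n)
  case (Suc n)
  have "of_real (jacobi_b \<nu> n) * ((x (Suc n) - x n) * (y (Suc n) - y n))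
      = - z * (\<Sum>k\<le>n. x k) * (y (Suc n) - y n)"
    using assms[unfolded jacobi_flux_def, rule_format, of n] by (metis mult.assoc)
  with Suc show ?case by (simp add: algebra_simps)
qed simp

text \<open>The growth allowed to the partial sums by \<open>ell2_sum_sublinear\<close> is exactly
  absorbed by the smallness of the entries along the subsequence.\<close>

lemma ell2_boundary_subseq:
  assumes "x \<in> ell2"
  obtains r :: "nat \<Rightarrow> nat" where "strict_mono r"
    "(\<lambda>j. (\<Sum>k\<le>r j. x k) * cnj (x (r j))) \<longlonglongrightarrow> 0"
proof -
  obtain r where r: "strict_mono r" "(\<lambda>j. sqrt (real (r j) + 1) * norm (x (r j))) \<longlonglongrightarrow> 0"
    using ell2_subseq_sqrt[OF assms] by blast
  have "(\<lambda>j. (\<Sum>k\<le>r j. norm (x k)) / sqrt (real (r j) + 1)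
            * (sqrt (real (r j) + 1) * norm (x (r j)))) \<longlonglongrightarrow> 0 * 0"
    using LIMSEQ_subseq_LIMSEQ[OF ell2_sum_sublinear[OF assms] r(1)]
    by (intro tendsto_mult r(2)) (simp add: o_def)
  moreover have "(\<Sum>k\<le>n. norm (x k)) / sqrt (real n + 1) * (sqrt (real n + 1) * norm (x n))
      = (\<Sum>k\<le>n. norm (x k)) * norm (x n)" for n by (simp add: add_eq_0_iff)
  ultimately have "(\<lambda>j. (\<Sum>k\<le>r j. norm (x k)) * norm (x (r j))) \<longlonglongrightarrow> 0" by simp
  then have "(\<lambda>j. (\<Sum>k\<le>r j. x k) * cnj (x (r j))) \<longlonglongrightarrow> 0"
    by (rule Lim_null_comparison[rotated])
       (auto intro!: always_eventually mult_right_mono norm_sum simp: norm_mult)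
  with r(1) show thesis using that by blast
qed

text \<open>Pairing the equation with the conjugate of \<open>x\<close> equates \<open>z\<close>
  times the squared norm with the limit of the nonnegative energies \<open>E (r j)\<close>. This
  leaves only real positive \<open>z\<close> and disposes of \<open>z = 0\<close>, the value
  belonging to the excluded \<open>s = 1\<close>.\<close>

lemma jacobi_eigenvalue_pos:
  assumes \<nu>: "\<nu> > 0" and x: "x \<in> ell2" "x \<noteq> (\<lambda>n. 0)" and F: "jacobi_flux \<nu> z x"
  obtains t where "t > 0" "z = of_real t"
proof -
  have sm: "summable (\<lambda>n. (norm (x n))\<^sup>2)" using x(1) by (simp add: ell2_def)
  define T where "T = (\<Sum>n. (norm (x n))\<^sup>2)"
  have x0: "x 0 \<noteq> 0" by (rule jacobi_flux_nonzero_0[OF \<nu> F x(2)])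
  have "T > 0" unfolding T_def by (rule suminf_pos2[OF sm, where i = 0]) (use x0 in auto)
  obtain r :: "nat \<Rightarrow> nat" where r: "strict_mono r"
    "(\<lambda>j. (\<Sum>k\<le>r j. x k) * cnj (x (r j))) \<longlonglongrightarrow> 0"
    using ell2_boundary_subseq[OF x(1)] by blast
  define E where "E = (\<lambda>n. \<Sum>k<n. jacobi_b \<nu> k * (norm (x (Suc k) - x k))\<^sup>2)"
  define S where "S = (\<lambda>n. \<Sum>k\<le>n. (norm (x k))\<^sup>2)"
  have green: "z * of_real (S n) - of_real (E n) = z * ((\<Sum>k\<le>n. x k) * cnj (x n))" for n
  proof -
    have "(\<Sum>k\<le>n. z * (x k * cnj (x k))) = z * of_real (S n)"
      by (simp add: S_def sum_distrib_left flip: complex_norm_square)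
    moreover have "(\<Sum>k<n. of_real (jacobi_b \<nu> k) * ((x (Suc k) - x k) * (cnj (x (Suc k)) - cnj (x k))))
        = of_real (E n)"
      by (simp add: E_def flip: complex_cnj_diff complex_norm_square)
    ultimately show ?thesis using green_flux[OF F, where y = "\<lambda>k. cnj (x k)" and n = n]
      by (simp add: mult.assoc algebra_simps)
  qed
  have lim: "(\<lambda>j. z * of_real (S (r j)) - of_real (E (r j))) \<longlonglongrightarrow> 0"
    unfolding green using tendsto_mult_right_zero[OF r(2)] by simp
  have "S \<longlonglongrightarrow> T" unfolding S_def T_def using summable_LIMSEQ'[OF sm] by simp
  then have SL: "(\<lambda>j. S (r j)) \<longlonglongrightarrow> T" using LIMSEQ_subseq_LIMSEQ[OF _ r(1)] by (simp add: o_def)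
  have "(\<lambda>j. Im z * S (r j)) \<longlonglongrightarrow> 0" using tendsto_Im[OF lim] by simp
  moreover have "(\<lambda>j. Im z * S (r j)) \<longlonglongrightarrow> Im z * T" by (intro tendsto_mult tendsto_const SL)
  ultimately have "Im z * T = 0" using LIMSEQ_unique by blast
  with \<open>T > 0\<close> have im: "Im z = 0" by simp
  have "(\<lambda>j. Re z * S (r j) - E (r j)) \<longlonglongrightarrow> 0" using tendsto_Re[OF lim] by simp
  from tendsto_diff[OF tendsto_mult[OF tendsto_const[of "Re z"] SL] this]
  have "(\<lambda>j. E (r j)) \<longlonglongrightarrow> Re z * T" by simp
  moreover have "E n \<ge> 0" for n
    unfolding E_def using jacobi_b_pos[OF \<nu>] by (intro sum_nonneg mult_nonneg_nonneg) (auto intro: less_imp_le)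
  ultimately have "Re z * T \<ge> 0" by (intro LIMSEQ_le_const) auto
  with \<open>T > 0\<close> have re: "Re z \<ge> 0" by (simp add: zero_le_mult_iff)
  \<comment> \<open>For \<open>z = 0\<close> the flux vanishes, so \<open>x\<close> would be a
    nonzero constant sequence.\<close>
  have "Re z \<noteq> 0"
  proof
    assume "Re z = 0"
    with im have "z = 0" by (simp add: complex_eq_iff)
    have "x n = x 0" for n
    proof (induction n)
      case (Suc n)
      have "complex_of_real (jacobi_b \<nu> n) \<noteq> 0"
        using jacobi_b_pos[OF \<nu>] by (metis less_irrefl of_real_eq_0_iff)
      then show ?case using F[unfolded jacobi_flux_def, rule_format, of n] Suc \<open>z = 0\<close> by simp
    qed simp
    then have "(\<lambda>n. (norm (x n))\<^sup>2) = (\<lambda>n. (norm (x 0))\<^sup>2)" by metis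
    with sm have "(\<lambda>n::nat. (norm (x 0))\<^sup>2) \<longlonglongrightarrow> 0" using summable_LIMSEQ_zero by metis
    then show False using x0 by (simp add: LIMSEQ_const_iff)
  qed
  with re im that[of "Re z"] show thesis by (simp add: complex_eq_iff)
qed

section \<open>The Wronskian argument\<close>

lemma sum_inverse_sqrt_le: "(\<Sum>k\<le>n. 1 / sqrt (real k + 1)) \<le> 2 * sqrt (real n + 1)"
proof (induction n)
  case (Suc n)
  define a b where "a = sqrt (real n + 1)" and "b = sqrt (real n + 2)"
  have ab: "a > 0" "b > 0" "b\<^sup>2 = a\<^sup>2 + 1" by (simp_all add: a_def b_def)
  have "2 * a * b \<le> a\<^sup>2 + b\<^sup>2" using sum_squares_bound[of a b] by simp
  with ab have "2 * a + 1 / b \<le> 2 * b" by (simp add: field_simps power2_eq_square)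
  then show ?case using Suc by (simp add: a_def b_def add.commute)
qed simp

lemma Bseq_sum_of_Bseq_sqrt:
  assumes "Bseq (\<lambda>n. sqrt (real n + 1) * norm (y n))"
  shows "Bseq (\<lambda>n. (\<Sum>k\<le>n. norm (y k)) / sqrt (real n + 1))"
proof -
  obtain K where K: "K > 0" "\<And>n. norm (sqrt (real n + 1) * norm (y n)) \<le> K"
    using assms by (auto simp: Bseq_def)
  have "norm ((\<Sum>k\<le>n. norm (y k)) / sqrt (real n + 1)) \<le> 2 * K" for n
  proof -
    have "norm (y k) \<le> K * (1 / sqrt (real k + 1))" for k
      using K(2)[of k] by (simp add: abs_mult field_simps)
    then have "(\<Sum>k\<le>n. norm (y k)) \<le> K * (\<Sum>k\<le>n. 1 / sqrt (real k + 1))"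
      unfolding sum_distrib_left by (intro sum_mono)
    also have "\<dots> \<le> K * (2 * sqrt (real n + 1))"
      using K(1) sum_inverse_sqrt_le by (intro mult_left_mono) auto
    finally show ?thesis by (simp add: field_simps abs_of_nonneg sum_nonneg)
  qed
  then show ?thesis by (intro BseqI'[of _ "2 * K"])
qed

text \<open>Each part of the Wronskian pairs a bounded quantity of \<open>phi\<close> with a
  quantity of \<open>x\<close> that vanishes along the subsequence; boundedness is all that the
  critical line offers. The Wronskian is constant, hence 0, and \<open>x 0\<close> is
  nonzero.\<close>

lemma jacobi_eigenvector_imp_hyp_Q_0:
  assumes \<nu>: "\<nu> > 0" and s: "Re s \<ge> 1/2" "s \<noteq> 1"
    and x: "x \<in> ell2" "x \<noteq> (\<lambda>n. 0)" and F: "jacobi_flux \<nu> (s * (1 - s)) x"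
  shows "hyp_Q s (of_real \<nu>) = 0"
proof -
  define z where "z = s * (1 - s)"
  define y where "y = phi s (of_real \<nu>)"
  define A where "A = - s * psi s (of_real \<nu>) 0"
  have s0: "Re s > 0" using s by simp
  have Fy: "of_real (jacobi_b \<nu> n) * (y (Suc n) - y n) = A - z * (\<Sum>k\<le>n. y k)" for n
    using phi_flux[OF s0 s(2) \<nu>, of n] by (simp add: A_def y_def z_def)
  have Fx: "of_real (jacobi_b \<nu> n) * (x (Suc n) - x n) = - z * (\<Sum>k\<le>n. x k)" for n
    using F by (simp add: jacobi_flux_def z_def)
  \<comment> \<open>the Wronskian \<open>b n * (x n * y (n + 1) - x (n + 1) * y n)\<close>, rewritten by means of the fluxes\<close>
  define W where "W = (\<lambda>n. x n * (A - z * (\<Sum>k\<le>n. y k)) + y n * (z * (\<Sum>k\<le>n. x k)))"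
  have W: "W n = x 0 * A" for n
  proof (induction n)
    case 0 show ?case by (simp add: W_def algebra_simps)
  next
    case (Suc n)
    have "W (Suc n) = x (Suc n) * (A - z * (\<Sum>k\<le>n. y k)) + y (Suc n) * (z * (\<Sum>k\<le>n. x k))"
      by (simp add: W_def algebra_simps)
    also have "\<dots> = W n + (x (Suc n) - x n) * (A - z * (\<Sum>k\<le>n. y k))
                       + (y (Suc n) - y n) * (z * (\<Sum>k\<le>n. x k))"
      by (simp add: W_def algebra_simps)
    also have "z * (\<Sum>k\<le>n. x k) = - (of_real (jacobi_b \<nu> n) * (x (Suc n) - x n))"
      unfolding Fx by simp
    finally show ?case using Suc by (simp flip: Fy)
  qed
  obtain r where r: "strict_mono r" "(\<lambda>j. sqrt (real (r j) + 1) * norm (x (r j))) \<longlonglongrightarrow> 0"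
    using ell2_subseq_sqrt[OF x(1)] by blast
  define sq where "sq = (\<lambda>n. sqrt (real n + 1))"
  have sq: "sq n \<ge> 1" for n by (simp add: sq_def)
  have By: "Bseq (\<lambda>n. sq n * norm (y n))"
    unfolding y_def sq_def using Bseq_sqrt_phi[of s "of_real \<nu>"] s \<nu> by simp
  obtain K where K: "\<And>n. sq n * norm (y n) \<le> K"
    using By by (auto simp: Bseq_def) (meson abs_le_D1)
  obtain L where L: "\<And>n. (\<Sum>k\<le>n. norm (y k)) / sq n \<le> L"
    using Bseq_sum_of_Bseq_sqrt[OF By[unfolded sq_def]] unfolding Bseq_def sq_def real_norm_def
    by (meson abs_le_D1)
  have bound: "norm (W n) \<le> sq n * norm (x n) * (norm A + norm z * L)
      + K * norm z * ((\<Sum>k\<le>n. norm (x k)) / sq n)" for n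
  proof -
    have p: "sq n > 0" using sq[of n] by simp
    have "norm (\<Sum>k\<le>n. y k) \<le> (\<Sum>k\<le>n. norm (y k))" by (rule norm_sum)
    also have "\<dots> \<le> sq n * L" using L[of n] p by (simp add: field_simps)
    finally have "norm (A - z * (\<Sum>k\<le>n. y k)) \<le> norm A + norm z * (sq n * L)"
      by (intro order_trans[OF norm_triangle_ineq4]) (simp add: norm_mult mult_left_mono)
    also have "\<dots> \<le> sq n * (norm A + norm z * L)"
      using mult_right_mono[OF sq[of n] norm_ge_zero[of A]] by (simp add: algebra_simps)
    finally have 1: "norm (x n * (A - z * (\<Sum>k\<le>n. y k))) \<le> sq n * norm (x n) * (norm A + norm z * L)"
      unfolding norm_mult using mult_left_mono[OF _ norm_ge_zero[of "x n"]] by (fastforce simp: mult_ac)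
    have "norm (y n) \<le> K / sq n" using K[of n] p by (simp add: field_simps)
    moreover have "norm (z * (\<Sum>k\<le>n. x k)) \<le> norm z * (\<Sum>k\<le>n. norm (x k))"
      unfolding norm_mult by (intro mult_left_mono norm_sum) auto
    ultimately have "norm (y n) * norm (z * (\<Sum>k\<le>n. x k)) \<le> (K / sq n) * (norm z * (\<Sum>k\<le>n. norm (x k)))"
      by (intro mult_mono) (auto intro: order_trans[OF norm_ge_zero])
    then have 2: "norm (y n * (z * (\<Sum>k\<le>n. x k))) \<le> K * norm z * ((\<Sum>k\<le>n. norm (x k)) / sq n)"
      by (simp add: norm_mult)
    show ?thesis unfolding W_def by (rule order_trans[OF norm_triangle_ineq add_mono[OF 1 2]])
  qed
  have "(\<lambda>j. sq (r j) * norm (x (r j)) * (norm A + norm z * L)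
      + K * norm z * ((\<Sum>k\<le>r j. norm (x k)) / sq (r j))) \<longlonglongrightarrow> 0 * (norm A + norm z * L) + K * norm z * 0"
    using LIMSEQ_subseq_LIMSEQ[OF ell2_sum_sublinear[OF x(1)] r(1)] r(2) unfolding sq_def
    by (intro tendsto_add tendsto_mult tendsto_const) (simp_all add: o_def)
  then have "(\<lambda>j. norm (W (r j))) \<longlonglongrightarrow> 0"
    by (intro Lim_null_comparison[of "\<lambda>j. norm (W (r j))"]) (use bound in auto)
  then have "x 0 * A = 0" unfolding W by (simp add: LIMSEQ_const_iff)
  moreover have "x 0 \<noteq> 0" by (rule jacobi_flux_nonzero_0[OF \<nu> F x(2)])
  moreover have "s \<noteq> 0" "of_real \<nu> + s \<noteq> 0" using s0 \<nu> by (auto simp: complex_eq_iff)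
  ultimately show ?thesis by (simp add: A_def psi_def gfac_def)
qed

subsection \<open>An implicit function theorem\<close>

text \<open>Holomorphic dependence of \<open>F\<close> on both arguments is expressed by stability under composition
  with holomorphic functions of one variable; the implicit function is a uniform limit of
  Newton-type iterates, which are holomorphic for that reason.\<close>

lemma holomorphic_implicit_function:
  fixes F :: "complex \<Rightarrow> complex \<Rightarrow> complex"
  assumes e: "e > 0"
    and cont: "continuous_on (ball a e \<times> ball c e) (\<lambda>(s, v). F s v)"
    and holo: "\<And>U f g. open U \<Longrightarrow> f holomorphic_on U \<Longrightarrow> g holomorphic_on U \<Longrightarrow> f ` U \<subseteq> ball a e
                 \<Longrightarrow> g ` U \<subseteq> ball c e \<Longrightarrow> (\<lambda>w. F (f w) (g w)) holomorphic_on U"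
    and zero: "F a c = 0" and D: "((\<lambda>s. F s c) has_field_derivative D) (at a)" "D \<noteq> 0"
  obtains r \<rho> h where "r > 0" "\<rho> > 0" "h holomorphic_on ball c r"
    "\<And>s v. v \<in> ball c r \<Longrightarrow> s \<in> cball a \<rho> \<Longrightarrow> F s v = 0 \<Longrightarrow> s = h v"
proof -
  \<comment> \<open>Newton map with frozen derivative: its fixed points in \<open>s\<close> are the
    zeros of \<open>F\<close>, and its \<open>s\<close>-derivative vanishes at
    \<open>(a, c)\<close>.\<close>
  define G where "G = (\<lambda>s v. s - F s v / D)"
  have holo_s: "(\<lambda>s. F s v) holomorphic_on ball a e" if "v \<in> ball c e" for v
    by (rule holo[of "ball a e" "\<lambda>s. s" "\<lambda>s. v"]) (use that in auto)
  have Gholo: "(\<lambda>s. G s v) holomorphic_on ball a e" if "v \<in> ball c e" for v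
    unfolding G_def using holo_s[OF that] D(2) by (intro holomorphic_intros) auto
  have c: "c \<in> ball c e" and a: "a \<in> ball a e" using e by auto
  have d0: "deriv (\<lambda>s. G s c) a = 0"
    by (rule DERIV_imp_deriv) (auto simp: G_def D(2) intro!: derivative_eq_intros D(1))
  have "(deriv (\<lambda>s. G s c)) holomorphic_on ball a e"
    by (intro holomorphic_deriv Gholo c) auto
  then have "isCont (deriv (\<lambda>s. G s c)) a"
    using a by (meson continuous_on_eq_continuous_at holomorphic_on_imp_continuous_on open_ball)
  then obtain \<delta> where \<delta>: "\<delta> > 0" "\<And>s. dist s a < \<delta> \<Longrightarrow> dist (deriv (\<lambda>s. G s c) s) 0 < 1/4"
    using d0 unfolding continuous_at_eps_delta by (metis zero_less_divide_1_iff zero_less_numeral)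
  \<comment> \<open>Leaves room for circles of radius \<open>\<rho>\<close> around points of
    \<open>cball a \<rho>\<close> inside \<open>ball a e\<close>, as the Cauchy estimate
    requires.\<close>
  define \<rho> where "\<rho> = min \<delta> e / 3"
  have \<rho>: "\<rho> > 0" "\<rho> < \<delta>" "2 * \<rho> < e" using \<delta>(1) e by (auto simp: \<rho>_def)
  have dG: "norm (deriv (\<lambda>s. G s c) s) \<le> 1/4" if "s \<in> cball a \<rho>" for s
    using \<delta>(2)[of s] that \<rho> by (simp add: dist_commute)
  have "uniformly_continuous_on (cball a (2 * \<rho>) \<times> cball c (e / 2)) (\<lambda>(s, v). F s v)"
    by (intro compact_uniformly_continuous compact_Times compact_cball continuous_on_subset[OF cont])
       (use \<rho> e in auto)
  moreover have "norm D * (\<rho> / 4) > 0" using D(2) \<rho> by simp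
  ultimately obtain \<eta> where \<eta>: "\<eta> > 0" and uc: "\<And>p q. p \<in> cball a (2 * \<rho>) \<times> cball c (e / 2) \<Longrightarrow>
       q \<in> cball a (2 * \<rho>) \<times> cball c (e / 2) \<Longrightarrow> dist q p < \<eta> \<Longrightarrow>
       dist (case q of (s, v) \<Rightarrow> F s v) (case p of (s, v) \<Rightarrow> F s v) < norm D * (\<rho> / 4)"
    unfolding uniformly_continuous_on_def by metis
  define r where "r = min \<eta> (e / 2)"
  have r: "r > 0" "r \<le> e / 2" "r \<le> \<eta>" using \<eta> e by (auto simp: r_def)
  \<comment> \<open>The Cauchy estimate on such circles turns \<open>\<rho> / 4\<close> into 1/4 for
    the derivatives; with \<open>dG\<close> this gives the contraction constant 1/2. Moreover
    \<open>\<rho> / 2 + \<rho> / 4\<close> stays below \<open>\<rho>\<close>, so the disc is mapped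
    into itself.\<close>
  have close: "norm (G s v - G s c) \<le> \<rho> / 4" if "s \<in> cball a (2 * \<rho>)" "v \<in> ball c r" for s v
  proof -
    have "dist (s, v) (s, c) < \<eta>" using that r by (simp add: dist_Pair_Pair dist_commute)
    moreover have "(s, c) \<in> cball a (2 * \<rho>) \<times> cball c (e / 2)"
      "(s, v) \<in> cball a (2 * \<rho>) \<times> cball c (e / 2)" using that r e by auto
    ultimately have "norm (F s v - F s c) < norm D * (\<rho> / 4)"
      using uc[of "(s, c)" "(s, v)"] by (simp add: dist_norm)
    moreover have "G s v - G s c = (F s c - F s v) / D"
      by (simp add: G_def diff_divide_distrib)
    ultimately show ?thesis using D(2)
      by (simp add: norm_divide norm_minus_commute pos_divide_le_eq mult.commute)
  qed
  have vball: "v \<in> ball c e" if "v \<in> ball c r" for v using that r e by auto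
  have lip: "norm (G s v - G t v) \<le> 1/2 * norm (s - t)"
    if v: "v \<in> ball c r" and s: "s \<in> cball a \<rho>" and t: "t \<in> cball a \<rho>" for s t v
  proof (rule field_differentiable_bound[where f' = "deriv (\<lambda>s. G s v)" and S = "cball a \<rho>"])
    fix u assume u: "u \<in> cball a \<rho>"
    then have ue: "u \<in> ball a e" using \<rho> by auto
    have fd: "(\<lambda>s. G s w) field_differentiable at u" if "w \<in> ball c e" for w
      using Gholo[OF that] ue by (meson holomorphic_on_imp_differentiable_at open_ball)
    show "((\<lambda>s. G s v) has_field_derivative deriv (\<lambda>s. G s v) u) (at u within cball a \<rho>)"
      using fd[OF vball[OF v]] by (meson DERIV_deriv_iff_field_differentiable has_field_derivative_at_within)
    have sub: "cball u \<rho> \<subseteq> cball a (2 * \<rho>)"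
      using u by (subst cball_subset_cball_iff) (auto simp: dist_commute)
    have "cball a (2 * \<rho>) \<subseteq> ball a e" using \<rho> by auto
    with sub have sub2: "cball u \<rho> \<subseteq> ball a e" by (rule subset_trans)
    have h: "(\<lambda>s. G s v - G s c) holomorphic_on ball a e"
      by (intro holomorphic_intros Gholo vball v c)
    have "norm ((deriv ^^ 1) (\<lambda>s. G s v - G s c) u) \<le> fact 1 * (\<rho> / 4) / \<rho> ^ 1"
    proof (rule Cauchy_inequality)
      show "(\<lambda>s. G s v - G s c) holomorphic_on ball u \<rho>"
        using h sub2 by (meson ball_subset_cball holomorphic_on_subset subset_trans)
      show "continuous_on (cball u \<rho>) (\<lambda>s. G s v - G s c)"
        using h sub2 by (meson holomorphic_on_imp_continuous_on holomorphic_on_subset)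
      show "norm (G x v - G x c) \<le> \<rho> / 4" if "norm (u - x) = \<rho>" for x
        using that sub v by (intro close) (auto simp: dist_norm)
    qed (use \<rho> in auto)
    then have "norm (deriv (\<lambda>s. G s v - G s c) u) \<le> 1/4" using \<rho> by simp
    moreover have "deriv (\<lambda>s. G s v - G s c) u = deriv (\<lambda>s. G s v) u - deriv (\<lambda>s. G s c) u"
      by (intro deriv_diff fd vball v c)
    ultimately have "norm (deriv (\<lambda>s. G s v) u - deriv (\<lambda>s. G s c) u) \<le> 1/4" by simp
    with dG[OF u] show "norm (deriv (\<lambda>s. G s v) u) \<le> 1/2"
      using norm_triangle_sub[of "deriv (\<lambda>s. G s v) u" "deriv (\<lambda>s. G s c) u"] by linarith
  qed (use s t in auto)
  have Ga: "G a c = a" by (simp add: G_def zero)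
  have self: "G s v \<in> cball a \<rho>" if v: "v \<in> ball c r" and s: "s \<in> cball a \<rho>" for s v
  proof -
    have "norm (G s v - G a v) \<le> 1/2 * norm (s - a)" using lip[OF v s, of a] \<rho> by simp
    moreover have "norm (G a v - a) \<le> \<rho> / 4" using close[OF _ v, of a] \<rho> Ga by simp
    moreover have "norm (s - a) \<le> \<rho>" using s by (simp add: dist_norm norm_minus_commute)
    moreover have "norm (G s v - a) \<le> norm (G s v - G a v) + norm (G a v - a)"
      using norm_triangle_ineq[of "G s v - G a v" "G a v - a"] by simp
    ultimately have "norm (G s v - a) \<le> \<rho>" using \<rho> by linarith
    then show ?thesis by (simp add: dist_norm norm_minus_commute)
  qed
  define h where "h = (\<lambda>v. THE s. s \<in> cball a \<rho> \<and> G s v = s)"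
  have fix1: "\<exists>!s. s \<in> cball a \<rho> \<and> G s v = s" if v: "v \<in> ball c r" for v
  proof (rule Banach_fix)
    show "complete (cball a \<rho>)" by (simp add: complete_eq_closed)
    show "(\<lambda>s. G s v) ` cball a \<rho> \<subseteq> cball a \<rho>" using self[OF v] by auto
    show "dist (G s v) (G t v) \<le> 1/2 * dist s t" if "s \<in> cball a \<rho>" "t \<in> cball a \<rho>" for s t
      using lip[OF v that] by (simp add: dist_norm)
  qed (use \<rho> in auto)
  have hfix: "h v \<in> cball a \<rho> \<and> G (h v) v = h v" if "v \<in> ball c r" for v
    unfolding h_def by (rule theI'[OF fix1[OF that]])
  \<comment> \<open>All iterates start at the constant \<open>a\<close>; the errors halve at a rate
    independent of \<open>v\<close>, which makes the convergence uniform.\<close>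
  define H where "H = (\<lambda>m::nat. rec_nat (\<lambda>v. a) (\<lambda>m u v. G (u v) v) m)"
  have H0: "H 0 = (\<lambda>v. a)" and HS: "H (Suc m) = (\<lambda>v. G (H m v) v)" for m
    by (simp_all add: H_def)
  have Hin: "H m v \<in> cball a \<rho>" if "v \<in> ball c r" for m v
    by (induction m) (use self[OF that] \<rho> in \<open>auto simp: H0 HS\<close>)
  have Hhol: "H m holomorphic_on ball c r" for m
  proof (induction m)
    case (Suc m)
    have "(\<lambda>v. F (H m v) v) holomorphic_on ball c r"
      using Hin[of _ m] \<rho> vball by (intro holo Suc) (auto, fastforce)
    then show ?case unfolding HS G_def using Suc D(2) by (intro holomorphic_intros) auto
  qed (simp add: H0)
  have err: "norm (H m v - h v) \<le> \<rho> * (1/2) ^ m" if v: "v \<in> ball c r" for m v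
  proof (induction m)
    case 0
    show ?case using hfix[OF v] by (simp add: H0 dist_norm)
  next
    case (Suc m)
    have "norm (H (Suc m) v - h v) = norm (G (H m v) v - G (h v) v)"
      using hfix[OF v] by (simp add: HS)
    also have "\<dots> \<le> 1/2 * norm (H m v - h v)" using lip[OF v Hin[OF v]] hfix[OF v] by blast
    finally show ?case using Suc by simp
  qed
  have lim: "uniform_limit (ball c r) H h sequentially"
  proof (rule uniform_limitI)
    fix \<epsilon> :: real assume \<epsilon>: "\<epsilon> > 0"
    have "(\<lambda>m. \<rho> * (1/2) ^ m) \<longlonglongrightarrow> 0"
      by (intro tendsto_mult_right_zero LIMSEQ_realpow_zero) auto
    then have "\<forall>\<^sub>F m in sequentially. \<rho> * (1/2) ^ m < \<epsilon>"
      using \<epsilon> by (rule order_tendstoD)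
    then show "\<forall>\<^sub>F m in sequentially. \<forall>v\<in>ball c r. dist (H m v) (h v) < \<epsilon>"
    proof eventually_elim
      case (elim m)
      then show ?case using err le_less_trans unfolding dist_norm by blast
    qed
  qed
  have "h holomorphic_on ball c r"
  proof (rule holomorphic_uniform_sequence[of "ball c r" H])
    fix v assume "v \<in> ball c r"
    then obtain d where d: "d > 0" "cball v d \<subseteq> ball c r" by (meson open_ball open_contains_cball)
    then show "\<exists>d>0. cball v d \<subseteq> ball c r \<and> uniform_limit (cball v d) H h sequentially"
      using uniform_limit_on_subset[OF lim] by blast
  qed (use Hhol in auto)
  moreover have "s = h v" if "v \<in> ball c r" "s \<in> cball a \<rho>" "F s v = 0" for s v
    using fix1[OF that(1)] hfix[OF that(1)] that(2,3) by (auto simp: G_def)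
  ultimately show thesis using that[of r \<rho> h] r \<rho> by blast
qed

text \<open>Powers of a real \<open>t\<close> are real, so the real part of the sum is obtained
  coefficientwise, and the radius of convergence does not shrink.\<close>

lemma has_fps_expansion_Re:
  assumes "f has_fps_expansion H"
  shows "(\<lambda>t::real. Re (f (of_real t))) has_fps_expansion Abs_fps (\<lambda>n. Re (fps_nth H n))"
proof -
  let ?H = "Abs_fps (\<lambda>n. Re (fps_nth H n))"
  have R: "fps_conv_radius H > 0" and ev: "\<forall>\<^sub>F z in nhds 0. eval_fps H z = f z"
    using assms by (auto simp: has_fps_expansion_def)
  have sms: "(\<lambda>n. fps_nth ?H n * t ^ n) sums Re (eval_fps H (of_real t))"
    if "ereal \<bar>t\<bar> < fps_conv_radius H" for t :: real
  proof -
    have "summable (\<lambda>n. fps_nth H n * complex_of_real t ^ n)"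
      using that by (intro summable_fps) simp
    then have "(\<lambda>n. fps_nth H n * complex_of_real t ^ n) sums eval_fps H (of_real t)"
      unfolding eval_fps_def by (rule summable_sums)
    then have "(\<lambda>n. Re (fps_nth H n * complex_of_real t ^ n)) sums Re (eval_fps H (of_real t))"
      by (rule sums_Re)
    then show ?thesis by (simp flip: of_real_power)
  qed
  have le: "fps_conv_radius H \<le> fps_conv_radius ?H"
    unfolding fps_conv_radius_def[of ?H]
  proof (rule conv_radius_geI_ex)
    fix r :: real assume r: "0 < r" "ereal r < fps_conv_radius H"
    show "\<exists>z. norm z = r \<and> summable (\<lambda>n. fps_nth ?H n * z ^ n)"
      using sms[of r] r by (intro exI[of _ r]) (auto simp: sums_iff)
  qed
  have "\<forall>\<^sub>F t in nhds (0::real). eval_fps H (of_real t) = f (of_real t)"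
    using ev by (rule eventually_compose_filterlim) (use tendsto_of_real[of "\<lambda>t. t" 0 "nhds 0"] in \<open>auto simp: filterlim_ident\<close>)
  moreover have "\<forall>\<^sub>F t in nhds (0::real). t \<in> eball 0 (fps_conv_radius H)"
    using R by (intro eventually_nhds_in_open) (auto simp: zero_ereal_def)
  ultimately have "\<forall>\<^sub>F t in nhds (0::real). eval_fps ?H t = Re (f (of_real t))"
  proof eventually_elim
    case (elim t)
    show ?case using sms[of t] elim by (simp add: eval_fps_def sums_iff)
  qed
  with R le show ?thesis by (auto simp: has_fps_expansion_def)
qed

subsection \<open>Analyticity of the characteristic function\<close>

text \<open>\<open>char_fun (x + 1/2) \<nu>\<close> is the hypergeometric function of the theorem with its first term split
  off; unlike in the original series, all parameters of the remaining one have positive real part.\<close>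

definition hyp_R :: "complex \<Rightarrow> complex \<Rightarrow> complex" where
  "hyp_R s v = (\<Sum>k. poch_ratio s (s + 1) (s + 2) 2 (2 * s + 1) (s + v + 1) k)"

definition char_fun :: "complex \<Rightarrow> complex \<Rightarrow> complex" where
  "char_fun s v = 1 + (s - 1) * (s + 1) / (2 * (s + v)) * hyp_R s v"

lemma poch_ratio_split_first:
  fixes s v :: "'a :: {real_normed_field, banach}"
  assumes "s \<noteq> 0"
  shows "poch_ratio (s - 1) s (s + 1) 1 (2 * s) (s + v) (Suc k)
    = (s - 1) * (s + 1) / (2 * (s + v)) * poch_ratio s (s + 1) (s + 2) 2 (2 * s + 1) (s + v + 1) k"
proof -
  have e: "s - 1 + 1 = s" "s + 1 + 1 = s + 2" "1 + 1 = (2::'a)" by auto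
  show ?thesis using assms
    by (simp add: poch_ratio_def pochhammer_rec e ac_simps del: distrib_left_numeral)
qed

lemma norm_pochhammer_le:
  assumes "norm (z::complex) \<le> a"
  shows "norm (pochhammer z k) \<le> pochhammer a k"
proof (induction k)
  case (Suc k)
  have "norm (z + of_nat k) \<le> a + real k"
    using norm_triangle_ineq[of z "of_nat k"] assms by simp
  moreover have "0 \<le> a" using assms norm_ge_zero order_trans by blast
  ultimately show ?case using Suc by (simp add: pochhammer_rec' norm_mult mult_mono)
qed simp

lemma norm_pochhammer_ge:
  assumes "0 < b" "b \<le> Re z"
  shows "pochhammer b k \<le> norm (pochhammer z k)"
proof (induction k)
  case (Suc k)
  have "b + real k \<le> norm (z + of_nat k)"
    using complex_Re_le_cmod[of "z + of_nat k"] assms by simp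
  moreover have "0 \<le> b + real k" "0 \<le> pochhammer b k"
    using assms by (auto intro: pochhammer_nonneg)
  ultimately show ?case using Suc by (simp add: pochhammer_rec' norm_mult mult_mono)
qed simp

text \<open>Majorant for the Weierstrass test: moduli bound numerator factors from above, real parts
  bound denominator factors from below, and the result is a real term of the same kind, summable by
  its excess.\<close>

lemma norm_poch_ratio_le:
  assumes "norm a1 \<le> A1" "norm a2 \<le> A2" "norm a3 \<le> A3"
    and "0 < B1" "B1 \<le> Re b1" "0 < B2" "B2 \<le> Re b2" "0 < B3" "B3 \<le> Re b3"
  shows "norm (poch_ratio a1 a2 a3 b1 b2 b3 k) \<le> poch_ratio A1 A2 A3 B1 B2 B3 k"
proof -
  have pos: "pochhammer B1 k > 0" "pochhammer B2 k > 0" "pochhammer B3 k > 0"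
    using assms by (auto intro: pochhammer_pos)
  have nn: "pochhammer A1 k \<ge> 0" "pochhammer A2 k \<ge> 0" "pochhammer A3 k \<ge> 0"
    using norm_pochhammer_le[OF assms(1), of k] norm_pochhammer_le[OF assms(2), of k]
      norm_pochhammer_le[OF assms(3), of k] norm_ge_zero order_trans by blast+
  show ?thesis
    unfolding poch_ratio_def norm_mult norm_divide
    using pos nn norm_pochhammer_le[OF assms(1), of k] norm_pochhammer_le[OF assms(2), of k]
      norm_pochhammer_le[OF assms(3), of k] norm_pochhammer_ge[OF assms(4,5), of k]
      norm_pochhammer_ge[OF assms(6,7), of k] norm_pochhammer_ge[OF assms(8,9), of k]
    by (intro frac_le mult_mono mult_nonneg_nonneg mult_pos_pos) auto
qed

text \<open>Provides the hypotheses of \<open>holomorphic_implicit_function\<close> with one common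
  radius.\<close>

lemma char_fun_regular:
  fixes s0 v0 :: real
  assumes "s0 > 0" "v0 > 0"
  obtains e where "e > 0"
    "continuous_on (ball (of_real s0) e \<times> ball (of_real v0) e) (\<lambda>(s, v). char_fun s v)"
    "\<And>U f g. open U \<Longrightarrow> f holomorphic_on U \<Longrightarrow> g holomorphic_on U \<Longrightarrow> f ` U \<subseteq> ball (of_real s0) e
        \<Longrightarrow> g ` U \<subseteq> ball (of_real v0) e \<Longrightarrow> (\<lambda>w. char_fun (f w) (g w)) holomorphic_on U"
proof -
  \<comment> \<open>The left side of the summability condition for the majorant \<open>M\<close> is
    \<open>1 + v0 - 7 * e\<close>, hence the 8; the 4 keeps the real part of \<open>s\<close>
    positive.\<close>
  define e where "e = min (v0 / 8) (s0 / 4)"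
  have e: "e > 0" "8 * e \<le> v0" "4 * e \<le> s0" using assms by (auto simp: e_def)
  define T where "T = (\<lambda>s v. poch_ratio s (s + 1) (s + 2) 2 (2 * s + 1) (s + v + (1::complex)))"
  define M where "M = poch_ratio (s0 + e) (s0 + 1 + e) (s0 + 2 + e) 2 (2 * s0 + 1 - 2 * e) (s0 + v0 + 1 - 2 * e)"
  let ?S = "ball (complex_of_real s0) e" and ?V = "ball (complex_of_real v0) e"
  have ReS: "\<bar>Re s - s0\<bar> < e" if "s \<in> ?S" for s
    using abs_Re_le_cmod[of "s - of_real s0"] that by (simp add: dist_norm norm_minus_commute)
  have ReV: "\<bar>Re v - v0\<bar> < e" if "v \<in> ?V" for v
    using abs_Re_le_cmod[of "v - of_real v0"] that by (simp add: dist_norm norm_minus_commute)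
  have nS: "norm (s + of_real c) \<le> s0 + c + e" if "s \<in> ?S" "c \<ge> 0" for s c
  proof -
    have "norm (s + of_real c) \<le> norm (s - of_real s0) + norm (complex_of_real (s0 + c))"
      using norm_triangle_ineq[of "s - of_real s0" "complex_of_real (s0 + c)"] by (simp add: algebra_simps)
    also have "norm (complex_of_real (s0 + c)) = s0 + c" using that assms by (simp only: norm_of_real)
    finally show ?thesis using that by (simp add: dist_norm norm_minus_commute)
  qed
  have smM: "summable M"
    unfolding M_def using e assms by (intro summable_poch_ratio_real) auto
  have TM: "norm (T s v k) \<le> M k" if "s \<in> ?S" "v \<in> ?V" for s v k
    unfolding T_def M_def
    using nS[OF that(1), of 0] nS[OF that(1), of 1] nS[OF that(1), of 2] ReS[OF that(1)] ReV[OF that(2)] e assms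
    by (intro norm_poch_ratio_le) auto
  have nz: "pochhammer 2 k * pochhammer (2 * s + 1) k * pochhammer (s + v + 1) k \<noteq> 0" "s + v \<noteq> 0"
    if "s \<in> ?S" "v \<in> ?V" for s v k
  proof -
    have "Re s > 0" "Re v > 0" using ReS[OF that(1)] ReV[OF that(2)] e assms by linarith+
    then have "pochhammer z k \<noteq> 0" if "z \<in> {2, 2 * s + 1, s + v + 1}" for z
      using that by (intro pochhammer_neq_0_of_not_nonpos_Ints Re_pos_not_nonpos_Ints) auto
    then show "pochhammer 2 k * pochhammer (2 * s + 1) k * pochhammer (s + v + 1) k \<noteq> 0" by simp
    show "s + v \<noteq> 0" using \<open>Re s > 0\<close> \<open>Re v > 0\<close> by (auto simp: complex_eq_iff)
  qed
  have lim: "uniform_limit (?S \<times> ?V) (\<lambda>n (s, v). \<Sum>k<n. T s v k) (\<lambda>(s, v). hyp_R s v) sequentially"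
    using Weierstrass_m_test[of "?S \<times> ?V" "\<lambda>k p. T (fst p) (snd p) k" M, OF _ smM] TM
    unfolding hyp_R_def T_def case_prod_unfold by auto
  have cT: "continuous_on (?S \<times> ?V) (\<lambda>(s, v). \<Sum>k<n. T s v k)" for n
    unfolding T_def poch_ratio_def case_prod_unfold
    by (intro continuous_intros) (use nz in auto)
  have cR: "continuous_on (?S \<times> ?V) (\<lambda>(s, v). hyp_R s v)"
    by (rule uniform_limit_theorem[OF _ lim]) (use cT in auto)
  have "continuous_on (?S \<times> ?V) (\<lambda>(s, v). char_fun s v)"
    unfolding char_fun_def case_prod_unfold
    by (intro continuous_intros cR[unfolded case_prod_unfold])
       (use nz(2) in \<open>auto simp del: distrib_left_numeral\<close>)
  moreover have "(\<lambda>w. char_fun (f w) (g w)) holomorphic_on U"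
    if U: "open U" and f: "f holomorphic_on U" and g: "g holomorphic_on U"
      and fU: "f ` U \<subseteq> ?S" and gU: "g ` U \<subseteq> ?V" for U f g
  proof -
    have nzU: "pochhammer 2 k * pochhammer (2 * f w + 1) k * pochhammer (f w + g w + 1) k \<noteq> 0"
      "f w + g w \<noteq> 0" if "w \<in> U" for w k
      using nz[of "f w" "g w"] that fU gU by blast+
    have "(\<lambda>w. hyp_R (f w) (g w)) holomorphic_on U"
    proof (rule holomorphic_uniform_sequence[OF U, of "\<lambda>n w. \<Sum>k<n. T (f w) (g w) k"])
      fix n show "(\<lambda>w. \<Sum>k<n. T (f w) (g w) k) holomorphic_on U"
        unfolding T_def poch_ratio_def pochhammer_prod
        using nzU f g
        by (intro holomorphic_intros) (auto simp flip: pochhammer_prod)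
    next
      fix w assume "w \<in> U"
      then obtain d where d: "d > 0" "cball w d \<subseteq> U" using U open_contains_cball by blast
      have "uniform_limit (cball w d) (\<lambda>n w. \<Sum>k<n. T (f w) (g w) k) (\<lambda>w. hyp_R (f w) (g w)) sequentially"
        using uniform_limit_compose'[OF lim, of "\<lambda>w. (f w, g w)" "cball w d"] d fU gU by auto
      with d show "\<exists>d>0. cball w d \<subseteq> U \<and> uniform_limit (cball w d) (\<lambda>n w. \<Sum>k<n. T (f w) (g w) k)
          (\<lambda>w. hyp_R (f w) (g w)) sequentially" by blast
    qed
    then show ?thesis
      unfolding char_fun_def using nzU(2) f g
      by (intro holomorphic_intros) (auto simp del: distrib_left_numeral)
  qed
  ultimately show thesis using that e(1) by blast
qed

subsection \<open>The point spectrum\<close>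

definition hypF :: "real \<Rightarrow> real \<Rightarrow> real" where
  "hypF x \<nu> = hyp3F2_at_1 (x - 1/2) (x + 1/2) (x + 3/2) (2 * x + 1) (x + \<nu> + 1/2)"

lemma summable_hyp_R_real:
  assumes "s > 0" "\<nu> > 0"
  shows "summable (poch_ratio s (s + 1) (s + 2) 2 (2 * s + 1) (s + \<nu> + (1::real)))"
  using assms by (intro summable_poch_ratio_real) auto

lemma hypF_eq_shifted:
  assumes s: "s > 0" and \<nu>: "\<nu> > 0"
  shows "hypF (s - 1/2) \<nu> = 1 + (s - 1) * (s + 1) / (2 * (s + \<nu>))
    * (\<Sum>k. poch_ratio s (s + 1) (s + 2) 2 (2 * s + 1) (s + \<nu> + 1) k)"
proof -
  let ?T = "poch_ratio (s - 1) s (s + 1) 1 (2 * s) (s + \<nu>)"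
  let ?R = "poch_ratio s (s + 1) (s + 2) 2 (2 * s + 1) (s + \<nu> + 1)"
  define q where "q = (s - 1) * (s + 1) / (2 * (s + \<nu>))"
  have TS: "?T (Suc k) = q * ?R k" for k
    unfolding q_def using s by (intro poch_ratio_split_first) simp
  have "(\<lambda>k. q * ?R k) sums (q * (\<Sum>k. ?R k))"
    by (intro sums_mult summable_sums summable_hyp_R_real s \<nu>)
  then have "?T sums (1 + q * (\<Sum>k. ?R k))"
    using sums_Suc_iff[of ?T "q * (\<Sum>k. ?R k)"] TS by (simp add: add.commute)
  moreover have "hypF (s - 1/2) \<nu> = (\<Sum>k. ?T k)"
    unfolding hypF_def hyp3F2_at_1_eq_suminf by (simp add: algebra_simps)
  ultimately show ?thesis by (simp add: sums_iff q_def)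
qed

text \<open>For \<open>x \<le> 1/2\<close> this displays 1 minus a product of nonnegative factors,
  from which growth in \<nu> can be read off.\<close>

lemma hypF_eq:
  assumes "x \<ge> 0" "\<nu> > 0"
  shows "hypF x \<nu> = 1 - (1/2 - x) * (x + 3/2) / 2 / (x + \<nu> + 1/2)
    * (\<Sum>k. poch_ratio (x + 1/2) (x + 3/2) (x + 5/2) 2 (2 * x + 2) (x + \<nu> + 3/2) k)"
proof -
  define s d where "s = x + 1/2" and "d = s - 1"
  have e: "x + 3/2 = s + 1" "x + 5/2 = s + 2" "2 * x + 2 = 2 * s + 1" "x + \<nu> + 3/2 = s + \<nu> + 1"
    "1/2 - x = - d" "x + \<nu> + 1/2 = s + \<nu>" and x: "x = s - 1/2"
    by (simp_all add: s_def d_def)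
  have "s > 0" using assms by (simp add: s_def)
  from hypF_eq_shifted[OF this assms(2)] show ?thesis
    unfolding e x[symmetric] s_def[symmetric] d_def[symmetric]
    by (simp add: divide_divide_eq_left del: distrib_left_numeral)
qed

lemma char_fun_of_real:
  assumes "x \<ge> 0" "\<nu> > 0"
  shows "char_fun (of_real (x + 1/2)) (of_real \<nu>) = of_real (hypF x \<nu>)"
proof -
  define s where "s = x + 1/2"
  have s: "s > 0" "x = s - 1/2" using assms by (auto simp: s_def)
  let ?R = "poch_ratio s (s + 1) (s + 2) 2 (2 * s + 1) (s + \<nu> + 1)"
  have "poch_ratio (complex_of_real s) (of_real s + 1) (of_real s + 2) 2 (2 * of_real s + 1)
      (of_real s + of_real \<nu> + 1) = (\<lambda>k. of_real (?R k))"
    by (rule ext) (simp flip: poch_ratio_of_real)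
  then have "hyp_R (of_real s) (of_real \<nu>) = of_real (\<Sum>k. ?R k)"
    unfolding hyp_R_def
    using suminf_of_real[where ?'a = complex, OF summable_hyp_R_real[OF s(1) assms(2)]] by simp
  then have "char_fun (of_real s) (of_real \<nu>)
      = of_real (1 + (s - 1) * (s + 1) / (2 * (s + \<nu>)) * (\<Sum>k. ?R k))"
    by (simp add: char_fun_def)
  moreover have "hypF x \<nu> = 1 + (s - 1) * (s + 1) / (2 * (s + \<nu>)) * (\<Sum>k. ?R k)"
    using hypF_eq_shifted[OF s(1) assms(2)] unfolding s(2)[symmetric] .
  ultimately show ?thesis unfolding s_def[symmetric] by (simp only:)
qed

lemma hyp_Q_of_real:
  assumes "x \<ge> 0" "x < 1/2" "\<nu> > 0"
  shows "hyp_Q (of_real (x + 1/2)) (of_real \<nu>) = of_real (hypF x \<nu>)"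
proof -
  define s where "s = x + 1/2"
  have s: "s > 0" "s \<noteq> 1" using assms by (auto simp: s_def)
  let ?T = "poch_ratio (s - 1) s (s + 1) 1 (2 * s) (\<nu> + s)"
  have eq: "poch_ratio (complex_of_real s - 1) (of_real s) (of_real s + 1) 1 (2 * of_real s)
      (of_real \<nu> + of_real s) = (\<lambda>k. of_real (?T k))"
    by (rule ext) (simp flip: poch_ratio_of_real)
  have "(\<lambda>k. complex_of_real (?T k)) sums hyp_Q (of_real s) (of_real \<nu>)"
    using sums_hyp_Q[of "of_real s" "of_real \<nu>"] s assms by (simp add: eq)
  then have "?T sums Re (hyp_Q (of_real s) (of_real \<nu>))"
    and "(\<lambda>k. 0) sums Im (hyp_Q (of_real s) (of_real \<nu>))"
    by (auto dest: sums_Re sums_Im)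
  moreover have "hypF x \<nu> = (\<Sum>k. ?T k)"
    unfolding hypF_def hyp3F2_at_1_eq_suminf s_def by (simp add: algebra_simps)
  ultimately show ?thesis by (simp add: complex_eq_iff sums_iff s_def)
qed

lemma phi_nonzero:
  assumes "Re s > 0" "Re v > 0"
  shows "phi s v \<noteq> (\<lambda>n. 0)"
proof
  assume "phi s v = (\<lambda>n. 0)"
  moreover obtain C where "C > 0" "(\<lambda>n. norm (phi s v n) * real n powr Re s) \<longlonglongrightarrow> C"
    using phi_asymp[OF assms] .
  ultimately show False by (simp add: LIMSEQ_const_iff)
qed

lemma point_spectrum_jacobi:
  assumes \<nu>: "\<nu> > 0"
  shows "point_spectrum (jacobi_dom \<nu>) (jacobi_op \<nu>)
    = {complex_of_real (1/4 - x\<^sup>2) | x. x \<in> {0<..<1/2} \<and> hypF x \<nu> = 0}"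
proof (intro set_eqI iffI)
  fix z assume "z \<in> point_spectrum (jacobi_dom \<nu>) (jacobi_op \<nu>)"
  then obtain x where x: "x \<in> ell2" "x \<noteq> (\<lambda>n. 0)" and F: "jacobi_flux \<nu> z x"
    by (auto simp: point_spectrum_jacobi_iff)
  obtain t where t: "t > 0" "z = of_real t" using jacobi_eigenvalue_pos[OF \<nu> x F] .
  show "z \<in> {complex_of_real (1/4 - x\<^sup>2) | x. x \<in> {0<..<1/2} \<and> hypF x \<nu> = 0}"
  proof (cases "t < 1/4")
    case True
    \<comment> \<open>Solves \<open>t = 1/4 - y\<^sup>2\<close>; positivity of \<open>t\<close>
      keeps \<open>y\<close> below 1/2, thus \<open>s\<close> away from 1.\<close>
    define y where "y = sqrt (1/4 - t)"
    have y: "y\<^sup>2 = 1/4 - t" "y > 0" using True by (auto simp: y_def)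
    have "y < sqrt (1/4)" unfolding y_def using t by (intro real_sqrt_less_mono) simp
    then have y2: "y < 1/2" by (simp add: real_sqrt_divide)
    have "(y + 1/2) * (1 - (y + 1/2)) = t" using y(1) by (simp add: power2_eq_square algebra_simps)
    then have z: "z = of_real (y + 1/2) * (1 - of_real (y + 1/2))"
      unfolding t(2) by (metis of_real_1 of_real_diff of_real_mult)
    have "hyp_Q (of_real (y + 1/2)) (of_real \<nu>) = 0"
      by (rule jacobi_eigenvector_imp_hyp_Q_0[OF \<nu> _ _ x F[unfolded z]])
         (use y y2 in \<open>auto simp: complex_eq_iff\<close>)
    then have "hypF y \<nu> = 0" using hyp_Q_of_real[of y \<nu>] y y2 \<nu> by simp
    then show ?thesis using y y2 t by (intro CollectI exI[of _ y]) auto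
  next
    case False
    \<comment> \<open>Now \<open>1/4 - t\<close> is nonpositive, so its root is imaginary and
      \<open>s\<close> lies on the critical line.\<close>
    define s where "s = Complex (1/2) (sqrt (t - 1/4))"
    have s: "Re s = 1/2" "s \<noteq> 1" by (auto simp: s_def complex_eq_iff)
    have z: "z = s * (1 - s)"
      using False by (auto simp: t(2) s_def complex_eq_iff)
    have "hyp_Q s (of_real \<nu>) = 0"
      by (rule jacobi_eigenvector_imp_hyp_Q_0[OF \<nu> _ _ x F[unfolded z]]) (use s in auto)
    then have Fp: "jacobi_flux \<nu> z (phi s (of_real \<nu>))"
      unfolding z using s \<nu> by (intro jacobi_flux_phi) auto
    have "x 0 \<noteq> 0" by (rule jacobi_flux_nonzero_0[OF \<nu> F x(2)])
    \<comment> \<open>Both sequences solve the same recursion, so \<open>phi\<close> would inherit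
      square summability from \<open>x\<close>.\<close>
    then have "phi s (of_real \<nu>) = (\<lambda>n. phi s (of_real \<nu>) 0 / x 0 * x n)"
      using jacobi_flux_unique[OF \<nu> F Fp] by (auto simp: field_simps)
    then have "phi s (of_real \<nu>) \<in> ell2" using ell2_mult[OF x(1)] by metis
    with phi_not_in_ell2[of s "of_real \<nu>"] s \<nu> show ?thesis by simp
  qed
next
  fix z assume "z \<in> {complex_of_real (1/4 - x\<^sup>2) | x. x \<in> {0<..<1/2} \<and> hypF x \<nu> = 0}"
  then obtain x where x: "0 < x" "x < 1/2" "hypF x \<nu> = 0" and z: "z = of_real (1/4 - x\<^sup>2)" by auto
  define s where "s = complex_of_real (x + 1/2)"
  have s: "Re s > 1/2" "s \<noteq> 1" using x by (auto simp: s_def complex_eq_iff)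
  have "z = s * (1 - s)" by (simp add: z s_def power2_eq_square algebra_simps complex_eq_iff)
  moreover have "hyp_Q s (of_real \<nu>) = 0" using hyp_Q_of_real[of x \<nu>] x \<nu> by (simp add: s_def)
  ultimately have "jacobi_flux \<nu> z (phi s (of_real \<nu>))"
    using s \<nu> jacobi_flux_phi by simp
  moreover have "phi s (of_real \<nu>) \<in> ell2" using s \<nu> by (intro phi_in_ell2) auto
  moreover have "phi s (of_real \<nu>) \<noteq> (\<lambda>n. 0)" using s \<nu> by (intro phi_nonzero) auto
  ultimately show "z \<in> point_spectrum (jacobi_dom \<nu>) (jacobi_op \<nu>)"
    by (auto simp: point_spectrum_jacobi_iff)
qed

subsection \<open>Comparison of eigenvalues\<close>

lemma phi_of_real:
  assumes s: "s > 0" and \<nu>: "\<nu> > 0"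
  obtains f :: "nat \<Rightarrow> real" where
    "phi (of_real s) (of_real \<nu>) = (\<lambda>n. of_real (f n))" "\<And>n. f n > 0"
proof -
  define T where "T = (\<lambda>n. poch_ratio s s (s + 1) 1 (2 * s) (\<nu> + real n + 1 + s))"
  define f where "f = (\<lambda>n. pochhammer (\<nu> + 1) n / pochhammer (\<nu> + 1 + s) n * (\<Sum>k. T n k))"
  have sm: "summable (T n)" for n
    unfolding T_def using s \<nu> by (intro summable_poch_ratio_real) (auto intro: add_pos_nonneg add_nonneg_pos)
  have "T n k > 0" for n k
    unfolding T_def poch_ratio_def using s \<nu>
    by (intro divide_pos_pos mult_pos_pos pochhammer_pos) auto
  then have "(\<Sum>k. T n k) > 0" for n by (intro suminf_pos sm)
  then have "f n > 0" for n
    unfolding f_def using s \<nu> by (intro mult_pos_pos divide_pos_pos pochhammer_pos) auto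
  moreover have "phi (of_real s) (of_real \<nu>) n = of_real (f n)" for n
  proof -
    have "poch_ratio (of_real s) (of_real s) (of_real s + 1) 1 (2 * of_real s)
        (of_real \<nu> + of_nat n + 1 + of_real s) = (\<lambda>k. complex_of_real (T n k))"
      unfolding T_def by (rule ext) (simp flip: poch_ratio_of_real)
    then have "hyp_P (of_real s) (of_real \<nu> + of_nat n) = of_real (\<Sum>k. T n k)"
      unfolding hyp_P_def hyp3F2_at_1_eq_suminf using suminf_of_real[where ?'a = complex, OF sm[of n]] by simp
    moreover have "gfac (of_real s) (of_real \<nu>) n
        = of_real (pochhammer (\<nu> + 1) n / pochhammer (\<nu> + 1 + s) n)"
      by (simp add: gfac_def flip: pochhammer_of_real)
    ultimately show ?thesis by (simp add: phi_def f_def)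
  qed
  ultimately show thesis using that by blast
qed

text \<open>Testing the eigenvalue equation of each eigenvector against the other one; the boundary terms
  vanish as long as the two decay rates add up to more than \<open>1\<close>, so one of the two may be the
  threshold resonance \<open>x = 0\<close>.\<close>

lemma eigenvalue_comparison:
  assumes x: "0 \<le> x1" "x1 < 1/2" "0 \<le> x2" "x2 < 1/2" "x1 > 0 \<or> x2 > 0"
    and \<nu>: "\<nu>1 > 0" "\<nu>2 > 0" and zero: "hypF x1 \<nu>1 = 0" "hypF x2 \<nu>2 = 0"
  obtains P :: real and D :: "nat \<Rightarrow> real" where "P > 0" "\<And>k. D k > 0"
    "(\<lambda>k. jacobi_b \<nu>1 k * D k) sums ((1/4 - x1\<^sup>2) * P)"
    "(\<lambda>k. jacobi_b \<nu>2 k * D k) sums ((1/4 - x2\<^sup>2) * P)"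
proof -
  have boundary: "(\<lambda>n. (\<Sum>k\<le>n. u k) * w n) \<longlonglongrightarrow> 0"
    if u: "u = phi (of_real (x + 1/2)) (of_real \<nu>)" and w: "w = phi (of_real (y + 1/2)) (of_real \<mu>)"
      and pos: "0 \<le> x" "0 \<le> y" "x > 0 \<or> y > 0" "\<nu> > 0" "\<mu> > 0" for u w x y \<nu> \<mu>
  proof -
    have "Bseq (\<lambda>n. sqrt (real n + 1) * norm (u n))" "Bseq (\<lambda>n. sqrt (real n + 1) * norm (w n))"
      unfolding u w using pos by (auto intro!: Bseq_sqrt_phi)
    note B = Bseq_sum_of_Bseq_sqrt[OF this(1)] this(2)
    let ?a = "\<lambda>n. (\<Sum>k\<le>n. norm (u k)) / sqrt (real n + 1)" and ?b = "\<lambda>n. sqrt (real n + 1) * norm (w n)"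
    have "(\<lambda>n. ?a n * ?b n) \<longlonglongrightarrow> 0"
    \<comment> \<open>Either positive exponent supplies the vanishing factor: for
      \<open>x > 0\<close> the partial sums of \<open>u\<close>, otherwise the entries of
      \<open>w\<close>.\<close>
    proof (cases "x > 0")
      case True
      then have "u \<in> ell2" unfolding u using pos by (intro phi_in_ell2) auto
      from ell2_sum_sublinear[OF this] B(2) show ?thesis
        unfolding tendsto_Zfun_iff diff_0_right
        by (rule bounded_bilinear.Zfun_prod_Bfun[OF bounded_bilinear_mult])
    next
      case False
      then have "?b \<longlonglongrightarrow> 0" unfolding w using pos by (intro sqrt_phi_tendsto_0) auto
      with B(1) show ?thesis
        unfolding tendsto_Zfun_iff diff_0_right
        by (rule bounded_bilinear.Bfun_prod_Zfun[OF bounded_bilinear_mult])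
    qed
    moreover have "?a n * ?b n = (\<Sum>k\<le>n. norm (u k)) * norm (w n)" for n by (simp add: add_eq_0_iff)
    ultimately have "(\<lambda>n. (\<Sum>k\<le>n. norm (u k)) * norm (w n)) \<longlonglongrightarrow> 0" by simp
    then show ?thesis
      by (rule Lim_null_comparison[rotated])
         (auto intro!: always_eventually mult_right_mono norm_sum simp: norm_mult)
  qed
  have sumform: "(\<lambda>k. jacobi_b \<nu> k * ((f (Suc k) - f k) * (g (Suc k) - g k)))
        sums ((1/4 - x\<^sup>2) * (\<Sum>k. f k * g k))"
    if f: "phi (of_real (x + 1/2)) (of_real \<nu>) = (\<lambda>n. of_real (f n))"
      and g: "phi (of_real (y + 1/2)) (of_real \<mu>) = (\<lambda>n. of_real (g n))"
      and pos: "0 \<le> x" "x < 1/2" "0 \<le> y" "x > 0 \<or> y > 0" "\<nu> > 0" "\<mu> > 0"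
      and z: "hypF x \<nu> = 0" and sm: "summable (\<lambda>k. f k * g k)"
    for f g :: "nat \<Rightarrow> real" and x y \<nu> \<mu>
  proof -
    let ?u = "phi (of_real (x + 1/2)) (of_real \<nu>)" and ?w = "phi (of_real (y + 1/2)) (of_real \<mu>)"
    define t where "t = 1/4 - x\<^sup>2"
    have t: "complex_of_real t = of_real (x + 1/2) * (1 - of_real (x + 1/2))"
      by (simp add: t_def power2_eq_square algebra_simps complex_eq_iff)
    have "hyp_Q (of_real (x + 1/2)) (of_real \<nu>) = 0"
      using hyp_Q_of_real[of x \<nu>] pos z by simp
    then have "jacobi_flux \<nu> (of_real t) ?u"
      unfolding t using pos by (intro jacobi_flux_phi) (auto simp: complex_eq_iff)
    note G = green_flux[OF this, where y = ?w, unfolded f g]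
    have G': "(\<Sum>k<n. jacobi_b \<nu> k * ((f (Suc k) - f k) * (g (Suc k) - g k)))
        = t * (\<Sum>k\<le>n. f k * g k) - t * ((\<Sum>k\<le>n. f k) * g n)" for n
    proof -
      have "complex_of_real (\<Sum>k\<le>n. t * (f k * g k))
        = of_real ((\<Sum>k<n. jacobi_b \<nu> k * ((f (Suc k) - f k) * (g (Suc k) - g k))) + t * (\<Sum>k\<le>n. f k) * g n)"
        using G[of n] by simp
      then show ?thesis unfolding of_real_eq_iff by (simp add: sum_distrib_left algebra_simps)
    qed
    have "(\<lambda>n. (\<Sum>k\<le>n. ?u k) * ?w n) \<longlonglongrightarrow> 0" using boundary pos by blast
    then have "(\<lambda>n. complex_of_real ((\<Sum>k\<le>n. f k) * g n)) \<longlonglongrightarrow> of_real 0"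
      unfolding f g by simp
    then have "(\<lambda>n. (\<Sum>k\<le>n. f k) * g n) \<longlonglongrightarrow> 0" by (simp only: tendsto_of_real_iff)
    then have "(\<lambda>n. t * (\<Sum>k\<le>n. f k * g k) - t * ((\<Sum>k\<le>n. f k) * g n))
        \<longlonglongrightarrow> t * (\<Sum>k. f k * g k) - t * 0"
      by (intro tendsto_diff tendsto_mult tendsto_const summable_LIMSEQ' sm)
    then show ?thesis unfolding sums_def G' t_def by simp
  qed
  \<comment> \<open>The flux is minus a positive eigenvalue times a sum of positive entries.\<close>
  have decr: "f (Suc n) < f n"
    if f: "phi (of_real (x + 1/2)) (of_real \<nu>) = (\<lambda>n. of_real (f n))" and fpos: "\<And>n. f n > 0"
      and pos: "0 \<le> x" "x < 1/2" "\<nu> > 0" and z: "hypF x \<nu> = 0"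
    for f :: "nat \<Rightarrow> real" and x \<nu> n
  proof -
    define t where "t = 1/4 - x\<^sup>2"
    have "x\<^sup>2 < (1/2)\<^sup>2" using pos by (intro power_strict_mono) auto
    then have t0: "t > 0" by (simp add: t_def power2_eq_square)
    have t: "complex_of_real t = of_real (x + 1/2) * (1 - of_real (x + 1/2))"
      by (simp add: t_def power2_eq_square algebra_simps complex_eq_iff)
    have "hyp_Q (of_real (x + 1/2)) (of_real \<nu>) = 0"
      using hyp_Q_of_real[of x \<nu>] pos z by simp
    then have "jacobi_flux \<nu> (of_real t) (\<lambda>n. of_real (f n))"
      unfolding t f[symmetric] using pos by (intro jacobi_flux_phi) (auto simp: complex_eq_iff)
    then have "complex_of_real (jacobi_b \<nu> n * (f (Suc n) - f n)) = of_real (- t * (\<Sum>k\<le>n. f k))"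
      by (simp add: jacobi_flux_def)
    then have "jacobi_b \<nu> n * (f (Suc n) - f n) = - t * (\<Sum>k\<le>n. f k)" unfolding of_real_eq_iff .
    moreover have "(\<Sum>k\<le>n. f k) > 0" using fpos by (intro sum_pos) auto
    ultimately have "jacobi_b \<nu> n * (f (Suc n) - f n) < 0" using t0 by simp
    then show ?thesis using jacobi_b_pos[OF pos(3), of n] by (simp add: mult_less_0_iff)
  qed
  obtain f where f: "phi (of_real (x1 + 1/2)) (of_real \<nu>1) = (\<lambda>n. of_real (f n))" "\<And>n. f n > 0"
    using phi_of_real[of "x1 + 1/2" \<nu>1] x \<nu> by auto
  obtain g where g: "phi (of_real (x2 + 1/2)) (of_real \<nu>2) = (\<lambda>n. of_real (g n))" "\<And>n. g n > 0"
    using phi_of_real[of "x2 + 1/2" \<nu>2] x \<nu> by auto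
  have "summable (\<lambda>n. norm (phi (of_real (x1 + 1/2)) (of_real \<nu>1) n) * norm (phi (of_real (x2 + 1/2)) (of_real \<nu>2) n))"
    using x \<nu> by (intro summable_phi_mult_phi) auto
  then have sm: "summable (\<lambda>n. f n * g n)"
    unfolding f g using f(2) g(2) by (simp add: abs_of_pos)
  define P where "P = (\<Sum>k. f k * g k)"
  \<comment> \<open>Symmetric in \<open>f\<close> and \<open>g\<close>, so that testing either
    equation against the other solution produces the same \<open>D\<close> and
    \<open>P\<close>.\<close>
  define D where "D = (\<lambda>k. (f (Suc k) - f k) * (g (Suc k) - g k))"
  have "P > 0" unfolding P_def using f(2) g(2) by (intro suminf_pos sm) auto
  moreover have "D k > 0" for k
    unfolding D_def using decr[OF f] decr[OF g] x \<nu> zero by (intro mult_neg_neg) auto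
  moreover have "(\<lambda>k. jacobi_b \<nu>1 k * D k) sums ((1/4 - x1\<^sup>2) * P)"
    unfolding D_def P_def by (rule sumform[OF f(1) g(1)]) (use x \<nu> zero sm in auto)
  moreover have "(\<lambda>k. jacobi_b \<nu>2 k * D k) sums ((1/4 - x2\<^sup>2) * P)"
    unfolding D_def P_def
    using sumform[OF g(1) f(1)] x \<nu> zero sm by (simp add: mult.commute disj_commute)
  ultimately show thesis using that by blast
qed

lemma jacobi_b_strict_mono:
  assumes "0 < \<nu>1" "\<nu>1 < \<nu>2"
  shows "jacobi_b \<nu>1 k < jacobi_b \<nu>2 k"
  unfolding jacobi_b_def using assms by (intro mult_strict_mono) auto

text \<open>Each of the two linear factors grows by at most \<open>\<nu>2 / \<nu>1\<close>, the
  quotient at offset 0; the bound is uniform in \<open>k\<close>.\<close>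

lemma jacobi_b_le_ratio:
  assumes "0 < \<nu>1" "\<nu>1 < \<nu>2"
  shows "jacobi_b \<nu>2 k \<le> (\<nu>2 / \<nu>1)\<^sup>2 * jacobi_b \<nu>1 k"
proof -
  have r: "\<nu>2 / \<nu>1 \<ge> 1" using assms by simp
  have "c + \<nu>2 \<le> \<nu>2 / \<nu>1 * (c + \<nu>1)" if "c \<ge> 0" for c
    using mult_right_mono[OF r that] assms by (simp add: distrib_left)
  from this[of "real k"] this[of "real k + 1"]
  have "(real k + \<nu>2) * (real k + 1 + \<nu>2) \<le> (\<nu>2 / \<nu>1 * (real k + \<nu>1)) * (\<nu>2 / \<nu>1 * (real k + 1 + \<nu>1))"
    using assms by (intro mult_mono) auto
  then show ?thesis by (simp add: jacobi_b_def power2_eq_square mult_ac add_ac)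
qed

text \<open>For equal \<nu> the two sums of \<open>eigenvalue_comparison\<close> coincide. The case
  of two zeros at 0, not covered there, is trivial.\<close>

lemma zero_comparison_same:
  assumes x: "0 \<le> x1" "x1 < 1/2" "0 \<le> x2" "x2 < 1/2"
    and \<nu>: "\<nu> > 0" and zero: "hypF x1 \<nu> = 0" "hypF x2 \<nu> = 0"
  shows "x1 = x2"
proof (cases "x1 > 0 \<or> x2 > 0")
  case True
  obtain P D where P: "P > 0" and S: "(\<lambda>k. jacobi_b \<nu> k * D k) sums ((1/4 - x1\<^sup>2) * P)"
    "(\<lambda>k. jacobi_b \<nu> k * D k) sums ((1/4 - x2\<^sup>2) * P)"
    using eigenvalue_comparison[OF x True \<nu> \<nu> zero] by blast
  from sums_unique2[OF S] P have "x1\<^sup>2 = x2\<^sup>2" by simp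
  with x show ?thesis by (simp add: power2_eq_iff_nonneg)
qed (use x in simp)

text \<open>The order comes from \<open>jacobi_b_strict_mono\<close>, the bound from
  \<open>jacobi_b_le_ratio\<close>, both summed against \<open>D\<close>. Squares appear because the
  eigenvalues are \<open>1/4 - x\<^sup>2\<close>.\<close>

lemma zero_comparison_less:
  assumes x: "0 \<le> x1" "x1 < 1/2" "0 \<le> x2" "x2 < 1/2" "x1 > 0 \<or> x2 > 0"
    and \<nu>: "0 < \<nu>1" "\<nu>1 < \<nu>2" and zero: "hypF x1 \<nu>1 = 0" "hypF x2 \<nu>2 = 0"
  shows "x2 < x1" and "x1\<^sup>2 - x2\<^sup>2 \<le> ((\<nu>2 / \<nu>1)\<^sup>2 - 1) / 4"
proof -
  have \<nu>2: "\<nu>2 > 0" using \<nu> by simp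
  obtain P D where P: "P > 0" and D: "\<And>k. D k > 0"
    and S: "(\<lambda>k. jacobi_b \<nu>1 k * D k) sums ((1/4 - x1\<^sup>2) * P)"
    "(\<lambda>k. jacobi_b \<nu>2 k * D k) sums ((1/4 - x2\<^sup>2) * P)"
    by (rule eigenvalue_comparison[OF x \<nu>(1) \<nu>2 zero]) (rule that)
  have dS: "(\<lambda>k. (jacobi_b \<nu>2 k - jacobi_b \<nu>1 k) * D k) sums ((x1\<^sup>2 - x2\<^sup>2) * P)"
    using sums_diff[OF S(2) S(1)] by (simp add: algebra_simps)
  have "(jacobi_b \<nu>2 k - jacobi_b \<nu>1 k) * D k > 0" for k
    using jacobi_b_strict_mono[OF \<nu>, of k] D[of k] by simp
  then have "(x1\<^sup>2 - x2\<^sup>2) * P > 0"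
    unfolding sums_unique[OF dS] by (intro suminf_pos sums_summable[OF dS])
  then have "x1\<^sup>2 > x2\<^sup>2" using P by (simp add: zero_less_mult_iff)
  then show "x2 < x1" using x by (meson not_le power_mono)
  have "jacobi_b \<nu>2 k * D k \<le> (\<nu>2 / \<nu>1)\<^sup>2 * (jacobi_b \<nu>1 k * D k)" for k
    using mult_right_mono[OF jacobi_b_le_ratio[OF \<nu>, of k] less_imp_le[OF D[of k]]] by (simp add: mult.assoc)
  then have "(1/4 - x2\<^sup>2) * P \<le> (\<nu>2 / \<nu>1)\<^sup>2 * ((1/4 - x1\<^sup>2) * P)"
    using sums_le[OF _ S(2) sums_mult[OF S(1)]] by blast
  then have "1/4 - x2\<^sup>2 \<le> (\<nu>2 / \<nu>1)\<^sup>2 * (1/4 - x1\<^sup>2)"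
    using P by (simp flip: mult.assoc)
  then have "x1\<^sup>2 - x2\<^sup>2 \<le> ((\<nu>2 / \<nu>1)\<^sup>2 - 1) * (1/4 - x1\<^sup>2)" by (simp add: algebra_simps)
  also have "\<dots> \<le> ((\<nu>2 / \<nu>1)\<^sup>2 - 1) * (1/4)"
    using \<nu> by (intro mult_left_mono) auto
  finally show "x1\<^sup>2 - x2\<^sup>2 \<le> ((\<nu>2 / \<nu>1)\<^sup>2 - 1) / 4" by simp
qed

subsection \<open>The characteristic function on the real axis\<close>

text \<open>The series \<open>R\<close> does not increase with \<nu> and is at least its first term
  1, so the drop of the prefactor \<open>1 / q\<close> alone accounts for the stated growth.\<close>

lemma hypF_increase:
  assumes x: "0 \<le> x" "x \<le> 1/2" and \<nu>: "0 < \<nu>1" "\<nu>1 < \<nu>2"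
  shows "hypF x \<nu>2 - hypF x \<nu>1
    \<ge> (1/2 - x) * (x + 3/2) / 2 * (1 / (x + \<nu>1 + 1/2) - 1 / (x + \<nu>2 + 1/2))"
proof -
  define R where "R = (\<lambda>\<nu>. \<Sum>k. poch_ratio (x + 1/2) (x + 3/2) (x + 5/2) 2 (2 * x + 2) (x + \<nu> + 3/2) k)"
  define A where "A = (1/2 - x) * (x + 3/2) / 2"
  define q1 q2 where "q1 = x + \<nu>1 + 1/2" and "q2 = x + \<nu>2 + 1/2"
  have A: "A \<ge> 0" using x by (simp add: A_def)
  have q: "0 < q1" "q1 < q2" using x \<nu> by (auto simp: q1_def q2_def)
  have F: "hypF x \<nu>1 = 1 - A / q1 * R \<nu>1" "hypF x \<nu>2 = 1 - A / q2 * R \<nu>2"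
    using hypF_eq[of x] x \<nu> by (simp_all add: A_def q1_def q2_def R_def)
  have sm: "summable (poch_ratio (x + 1/2) (x + 3/2) (x + 5/2) 2 (2 * x + 2) (x + \<nu> + 3/2))" if "\<nu> > 0" for \<nu>
    using x that by (intro summable_poch_ratio_real) auto
  have mono: "pochhammer a k \<le> pochhammer b k" if "0 < a" "a \<le> b" for a b :: real and k
    unfolding pochhammer_prod using that by (intro prod_mono) auto
  have "R \<nu>2 \<le> R \<nu>1"
    unfolding R_def
  proof (intro suminf_le sm)
    show "poch_ratio (x + 1/2) (x + 3/2) (x + 5/2) 2 (2 * x + 2) (x + \<nu>2 + 3/2) k
       \<le> poch_ratio (x + 1/2) (x + 3/2) (x + 5/2) 2 (2 * x + 2) (x + \<nu>1 + 3/2) k" for k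
      unfolding poch_ratio_def using x \<nu>
      by (intro divide_left_mono mult_left_mono mono mult_pos_pos mult_nonneg_nonneg pochhammer_pos pochhammer_nonneg) auto
  qed (use \<nu> in auto)
  moreover have "1 \<le> R \<nu>2"
  proof -
    have "(\<Sum>k<1. poch_ratio (x + 1/2) (x + 3/2) (x + 5/2) 2 (2 * x + 2) (x + \<nu>2 + 3/2) k) \<le> R \<nu>2"
      unfolding R_def using x \<nu> unfolding poch_ratio_def[abs_def]
      by (intro sum_le_suminf sm[unfolded poch_ratio_def[abs_def]])
         (auto intro!: divide_nonneg_nonneg mult_nonneg_nonneg pochhammer_nonneg)
    then show ?thesis by simp
  qed
  ultimately have "1 / q1 - 1 / q2 \<le> R \<nu>1 / q1 - R \<nu>2 / q2"
  proof -
    have "(1 / q1 - 1 / q2) * 1 \<le> (1 / q1 - 1 / q2) * R \<nu>2"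
      using q \<open>1 \<le> R \<nu>2\<close> by (intro mult_left_mono) (auto simp: frac_le)
    also have "\<dots> \<le> R \<nu>1 / q1 - R \<nu>2 / q2"
      using q \<open>R \<nu>2 \<le> R \<nu>1\<close> by (simp add: left_diff_distrib divide_right_mono)
    finally show ?thesis by simp
  qed
  then have "A * (1 / q1 - 1 / q2) \<le> A * (R \<nu>1 / q1 - R \<nu>2 / q2)"
    using A by (rule mult_left_mono)
  then show ?thesis unfolding F A_def[symmetric] q1_def[symmetric] q2_def[symmetric]
    by (simp add: algebra_simps)
qed

lemma hypF_strict_mono:
  assumes x: "0 \<le> x" "x < 1/2" and \<nu>: "0 < \<nu>1" "\<nu>1 < \<nu>2"
  shows "hypF x \<nu>1 < hypF x \<nu>2"
proof -
  have "(1/2 - x) * (x + 3/2) / 2 * (1 / (x + \<nu>1 + 1/2) - 1 / (x + \<nu>2 + 1/2)) > 0"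
    using x \<nu> by (intro mult_pos_pos) (auto simp: frac_less2)
  then show ?thesis using hypF_increase[of x \<nu>1 \<nu>2] x \<nu> by simp
qed

lemma hypF_half: "\<nu> > 0 \<Longrightarrow> hypF (1/2) \<nu> = 1"
  using hypF_eq[of "1/2" \<nu>] by simp

lemma isCont_char_fun:
  fixes s0 v0 :: real
  assumes "s0 > 0" "v0 > 0"
  shows "isCont (\<lambda>(s, v). char_fun s v) (of_real s0, of_real v0)"
proof -
  obtain e where e: "e > 0" "continuous_on (ball (of_real s0) e \<times> ball (of_real v0) e) (\<lambda>(s, v). char_fun s v)"
    by (rule char_fun_regular[OF assms]) (rule that)
  then have "\<forall>p \<in> ball (of_real s0) e \<times> ball (of_real v0) e. isCont (\<lambda>(s, v). char_fun s v) p"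
    using continuous_on_eq_continuous_at[OF open_Times[OF open_ball open_ball]] by blast
  then show ?thesis using e(1) by simp
qed

text \<open>Phrased with \<open>char_fun\<close> because it is regular on both sides of
  \<open>x = 0\<close>, while \<open>char_fun_of_real\<close> identifies it with \<open>hypF\<close>
  only for \<open>x \<ge> 0\<close>.\<close>

lemma isCont_hypF:
  assumes "x > -1/2" "\<nu> > 0"
  shows "isCont (\<lambda>y. Re (char_fun (of_real (y + 1/2)) (of_real \<nu>))) x"
    and "isCont (\<lambda>\<mu>. Re (char_fun (of_real (x + 1/2)) (of_real \<mu>))) \<nu>"
proof -
  have c: "isCont (\<lambda>(s, v). char_fun s v) (of_real (x + 1/2), of_real \<nu>)"
    using assms by (intro isCont_char_fun) auto
  have "isCont (\<lambda>y. case (complex_of_real (y + 1/2), complex_of_real \<nu>) of (s, v) \<Rightarrow> char_fun s v) x"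
    using c by (intro isCont_o2[where g = "\<lambda>(s, v). char_fun s v"
          and f = "\<lambda>y. (of_real (y + 1/2), of_real \<nu>)"] continuous_intros)
  then show "isCont (\<lambda>y. Re (char_fun (of_real (y + 1/2)) (of_real \<nu>))) x" by (auto intro: isCont_Re)
  have "isCont (\<lambda>\<mu>. case (complex_of_real (x + 1/2), complex_of_real \<mu>) of (s, v) \<Rightarrow> char_fun s v) \<nu>"
    using c by (intro isCont_o2[where g = "\<lambda>(s, v). char_fun s v"
          and f = "\<lambda>\<mu>. (of_real (x + 1/2), of_real \<mu>)"] continuous_intros)
  then show "isCont (\<lambda>\<mu>. Re (char_fun (of_real (x + 1/2)) (of_real \<mu>))) \<nu>" by (auto intro: isCont_Re)
qed

lemma continuous_on_hypF:
  shows "\<nu> > 0 \<Longrightarrow> continuous_on {0..1/2} (\<lambda>x. hypF x \<nu>)"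
    and "0 \<le> x \<Longrightarrow> 0 < a \<Longrightarrow> continuous_on {a..b} (hypF x)"
proof -
  assume \<nu>: "\<nu> > 0"
  have "continuous_on {0..1/2} (\<lambda>y. Re (char_fun (of_real (y + 1/2)) (of_real \<nu>)))"
    by (rule continuous_at_imp_continuous_on, rule ballI, rule isCont_hypF(1)) (use \<nu> in auto)
  then show "continuous_on {0..1/2} (\<lambda>x. hypF x \<nu>)"
    by (rule continuous_on_eq) (use \<nu> char_fun_of_real in auto)
next
  assume x: "0 \<le> x" "0 < a"
  have "continuous_on {a..b} (\<lambda>\<mu>. Re (char_fun (of_real (x + 1/2)) (of_real \<mu>)))"
    by (rule continuous_at_imp_continuous_on, rule ballI, rule isCont_hypF(2)) (use x in auto)
  then show "continuous_on {a..b} (hypF x)"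
    by (rule continuous_on_eq) (use x char_fun_of_real in auto)
qed

section \<open>Signs at x = 0\<close>

text \<open>The series in \<open>hypF_eq\<close> diverges to infinity at \<open>x = 0\<close> as
  \<nu> tends to 0, so the value is negative for small \<nu>; 1/100 is small enough.\<close>

lemma hypF_0_small: "hypF 0 (1/100) < 0"
proof -
  let ?T = "poch_ratio (1/2) (3/2) (5/2) 2 2 (1/100 + 3/2 :: real)"
  have sm: "summable ?T" by (intro summable_poch_ratio_real) auto
  have "(\<Sum>k<3. ?T k) \<le> (\<Sum>k. ?T k)"
    by (intro sum_le_suminf sm)
       (auto simp: poch_ratio_def intro!: divide_nonneg_nonneg mult_nonneg_nonneg pochhammer_nonneg)
  \<comment> \<open>The prefactor is 3/8 divided by 51/100, so the sum must exceed 1.36; two terms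
    would fall short.\<close>
  moreover have "(\<Sum>k<3. ?T k) > 1.37"
    by (simp add: poch_ratio_def numeral_3_eq_3 pochhammer_rec')
  ultimately have "(\<Sum>k. ?T k) > 1.37" by (rule less_le_trans[rotated])
  then show ?thesis using hypF_eq[of 0 "1/100"] by simp
qed

text \<open>With \<open>q k = (1/2)_k / k!\<close>, the product \<open>(2k+1) (q k)\<^sup>2\<close> is decreasing, hence at most \<open>3/4\<close> for
  \<open>k \<ge> 1\<close>, and \<open>q (k-1) - q k = q k / (2k-1)\<close> makes the resulting majorant telescope.\<close>

lemma hypF_0_half: "hypF 0 (1/2) > 0"
proof -
  define q where "q = (\<lambda>k. pochhammer (1/2) k / pochhammer (1::real) k)"
  let ?T = "poch_ratio (- 1/2) (1/2) (3/2) 1 1 (1::real)"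
  have qS: "q (Suc k) = q k * ((2 * real k + 1) / (2 * real k + 2))" for k
    by (simp add: q_def pochhammer_rec' field_simps)
  have q0: "q k > 0" for k by (simp add: q_def pochhammer_pos)
  have wallis: "(q (Suc k))\<^sup>2 * (2 * real k + 3) \<le> 3/4" for k
  proof (induction k)
    case 0
    show ?case by (simp add: q_def power2_eq_square)
  next
    case (Suc k)
    have "((2 * real k + 3) / (2 * real k + 4))\<^sup>2 * (2 * real k + 5) \<le> 2 * real k + 3"
    proof -
      have "(2 * real k + 3)\<^sup>2 * (2 * real k + 5) \<le> (2 * real k + 3) * (2 * real k + 4)\<^sup>2"
        by (simp add: power2_eq_square algebra_simps)
      then show ?thesis by (simp add: power_divide pos_divide_le_eq)
    qed
    then have "(q (Suc k))\<^sup>2 * (((2 * real k + 3) / (2 * real k + 4))\<^sup>2 * (2 * real k + 5))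
        \<le> (q (Suc k))\<^sup>2 * (2 * real k + 3)" by (intro mult_left_mono) auto
    moreover have "(q (Suc (Suc k)))\<^sup>2 = (q (Suc k))\<^sup>2 * ((2 * real k + 3) / (2 * real k + 4))\<^sup>2"
      unfolding qS[of "Suc k"] power_mult_distrib by (simp add: add_ac)
    ultimately have "(q (Suc (Suc k)))\<^sup>2 * (2 * real k + 5) \<le> (q (Suc k))\<^sup>2 * (2 * real k + 3)"
      by (simp only: mult.assoc)
    moreover have "2 * real (Suc k) + 3 = 2 * real k + 5" by simp
    ultimately show ?case using Suc by (simp only:)
  qed
  have TS: "?T (Suc k) = - (q (Suc k) ^ 3) * (2 * real k + 3) / (2 * real k + 1)" for k
  proof -
    have 1: "pochhammer (-1/2) (Suc k) = - pochhammer (1/2 :: real) (Suc k) / (2 * real k + 1)"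
      using pochhammer_rec[of "-1/2 :: real" k] pochhammer_rec'[of "1/2 :: real" k]
      by (simp add: field_simps)
    have 2: "pochhammer (3/2) (Suc k) = pochhammer (1/2 :: real) (Suc k) * (2 * real k + 3)"
      using pochhammer_rec[of "1/2 :: real" "Suc k"] pochhammer_rec'[of "1/2 :: real" "Suc k"]
      by (simp add: field_simps)
    show ?thesis unfolding poch_ratio_def 1 2 q_def by (simp add: power3_eq_cube ac_simps)
  qed
  have le: "- (3/4) * (q k - q (Suc k)) \<le> ?T (Suc k)" for k
  proof -
    have "x - x * (A / (A + 1)) = x * (A / (A + 1)) / A" if "A > 0" for x A :: real
    proof -
      have "A + 1 \<noteq> 0" using that by simp
      then have "x - x * (A / (A + 1)) = x / (A + 1)" by (simp add: field_simps)
      then show ?thesis using that by simp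
    qed
    from this[of "2 * real k + 1" "q k"] have "q k - q (Suc k) = q (Suc k) / (2 * real k + 1)"
      unfolding qS by (simp add: add.commute)
    moreover have "((q (Suc k))\<^sup>2 * (2 * real k + 3)) * (q (Suc k) / (2 * real k + 1))
        \<le> 3/4 * (q (Suc k) / (2 * real k + 1))"
      using q0[of "Suc k"] by (intro mult_right_mono wallis) auto
    ultimately show ?thesis unfolding TS by (simp add: power3_eq_cube power2_eq_square mult_ac)
  qed
  have F: "hypF 0 (1/2) = (\<Sum>k. ?T k)"
    unfolding hypF_def hyp3F2_at_1_eq_suminf by simp
  have "summable (\<lambda>k. norm (poch_ratio (complex_of_real (- 1/2)) (of_real (1/2)) (of_real (3/2))
                                        (of_real 1) (of_real 1) (of_real 1) k))"
  proof (rule summable_norm_poch_ratio)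
    show "complex_of_real (- 1/2) \<notin> \<int>\<^sub>\<le>\<^sub>0"
      using Re_pos_minus_1_not_nonpos_Ints[of "1/2"] by (simp add: complex_eq_iff)
  qed (auto intro!: Re_pos_not_nonpos_Ints)
  then have sm: "summable ?T" unfolding poch_ratio_of_real by (simp add: summable_rabs_cancel)
  \<comment> \<open>The majorant telescopes to at most 3/4. The bound is uniform in
    \<open>n\<close>, since mere positivity would be lost in the limit.\<close>
  have part: "(\<Sum>k<Suc n. ?T k) \<ge> 1/4" for n
  proof -
    have "- (3/4) * (q 0 - q n) = (\<Sum>k<n. - (3/4) * (q k - q (Suc k)))"
      unfolding sum_distrib_left[symmetric] by (simp add: sum_lessThan_telescope')
    also have "\<dots> \<le> (\<Sum>k<n. ?T (Suc k))" by (intro sum_mono le)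
    finally have "- (3/4) * (q 0 - q n) \<le> (\<Sum>k<n. ?T (Suc k))" .
    moreover have "q 0 = 1" by (simp add: q_def)
    moreover have "(\<Sum>k<Suc n. ?T k) = 1 + (\<Sum>k<n. ?T (Suc k))"
      by (subst sum.lessThan_Suc_shift) simp
    moreover have "1/4 \<le> 1 + X" if "- (3/4) * (1 - c) \<le> X" "0 < c" for c X :: real
      using that by (simp add: field_simps)
    ultimately show ?thesis using q0[of n] by (simp only:)
  qed
  have "(\<lambda>n. \<Sum>k<Suc n. ?T k) \<longlonglongrightarrow> (\<Sum>k. ?T k)"
    by (intro LIMSEQ_Suc summable_LIMSEQ sm)
  then have "1/4 \<le> (\<Sum>k. ?T k)" by (rule LIMSEQ_le_const) (use part in blast)
  with F show ?thesis by simp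
qed

subsection \<open>The threshold and the zero curve\<close>

lemma ex1_threshold:
  obtains \<nu>0 where "0 < \<nu>0" "\<nu>0 < 1/2" "\<And>\<nu>. \<nu> > 0 \<Longrightarrow> hypF 0 \<nu> = 0 \<longleftrightarrow> \<nu> = \<nu>0"
    "\<And>\<nu>. 0 < \<nu> \<Longrightarrow> \<nu> < \<nu>0 \<Longrightarrow> hypF 0 \<nu> < 0"
proof -
  have "\<exists>\<nu>\<ge>1/100. \<nu> \<le> 1/2 \<and> hypF 0 \<nu> = 0"
    using hypF_0_small hypF_0_half continuous_on_hypF(2)[of 0 "1/100" "1/2"]
    by (intro IVT') auto
  then obtain \<nu>0 where \<nu>0: "1/100 \<le> \<nu>0" "\<nu>0 \<le> 1/2" "hypF 0 \<nu>0 = 0" by blast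
  then have "\<nu>0 \<noteq> 1/2" using hypF_0_half \<nu>0(3) by (metis less_irrefl)
  with \<nu>0 have "0 < \<nu>0" "\<nu>0 < 1/2" by linarith+
  moreover have "hypF 0 \<nu> < 0" if "0 < \<nu>" "\<nu> < \<nu>0" for \<nu>
    using hypF_strict_mono[of 0 \<nu> \<nu>0] that \<nu>0 by simp
  moreover have "hypF 0 \<nu> > 0" if "\<nu>0 < \<nu>" for \<nu>
    using hypF_strict_mono[of 0 \<nu>0 \<nu>] that \<nu>0 by simp
  ultimately show thesis using that[of \<nu>0] \<nu>0(3) by (metis less_irrefl linorder_neqE)
qed

text \<open>At \<open>x = 1/2\<close> the first parameter vanishes and the value is 1, so the sign
  changes on the interval.\<close>

lemma ex_zero:
  assumes "\<nu> > 0" "hypF 0 \<nu> < 0"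
  obtains x where "0 < x" "x < 1/2" "hypF x \<nu> = 0"
proof -
  have "\<exists>x\<ge>0. x \<le> 1/2 \<and> hypF x \<nu> = 0"
    using assms hypF_half[of \<nu>] continuous_on_hypF(1)[of \<nu>] by (intro IVT') auto
  then obtain x where x: "0 \<le> x" "x \<le> 1/2" "hypF x \<nu> = 0" by blast
  have "x \<noteq> 0" using x assms by auto
  moreover have "x \<noteq> 1/2" using x(3) hypF_half[OF assms(1)] by (metis zero_neq_one)
  ultimately show thesis using x that by (metis less_eq_real_def)
qed

text \<open>Continuity of the chosen zeros comes from the comparison bound; it places them in the
  disc where the implicit function is the only zero.\<close>

lemma real_analytic_at_zero_curve:
  fixes x0 :: "real \<Rightarrow> real"
  assumes c: "0 < c" "c < \<nu>0" and \<nu>0: "\<nu>0 < 1/2"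
    and x0: "\<And>\<nu>. 0 < \<nu> \<Longrightarrow> \<nu> < \<nu>0 \<Longrightarrow> 0 < x0 \<nu> \<and> x0 \<nu> < 1/2 \<and> hypF (x0 \<nu>) \<nu> = 0"
  shows "\<exists>F. (\<lambda>h. x0 (c + h)) has_fps_expansion F"
proof -
  define a where "a = x0 c"
  have a: "0 < a" "a < 1/2" "hypF a c = 0" using x0[OF c] by (auto simp: a_def)
  have diff: "x0 \<nu>2 < x0 \<nu>1 \<and> (x0 \<nu>1)\<^sup>2 - (x0 \<nu>2)\<^sup>2 \<le> ((\<nu>2 / \<nu>1)\<^sup>2 - 1) / 4"
    if "0 < \<nu>1" "\<nu>1 < \<nu>2" "\<nu>2 < \<nu>0" for \<nu>1 \<nu>2
    using zero_comparison_less[of "x0 \<nu>1" "x0 \<nu>2" \<nu>1 \<nu>2] x0[of \<nu>1] x0[of \<nu>2] that by auto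
  have near: "\<forall>\<^sub>F \<nu> in nhds c. \<nu> \<in> {0<..<\<nu>0}"
    using c by (intro eventually_nhds_in_open) auto
  have cont: "(x0 \<longlongrightarrow> a) (nhds c)"
  proof -
    \<comment> \<open>The comparison bound made symmetric in \<open>\<nu>\<close> and
      \<open>c\<close>, so that both sides of \<open>c\<close> are treated alike.\<close>
    define M where "M = (\<lambda>\<nu>. ((max \<nu> c / min \<nu> c)\<^sup>2 - 1) / 4)"
    have "isCont M c" unfolding M_def using c by (intro continuous_intros) auto
    then have "(M \<longlongrightarrow> 0) (nhds c)" using c tendsto_at_iff_tendsto_nhds[of M c]
      by (simp add: isCont_def M_def)
    then have "((\<lambda>\<nu>. sqrt (M \<nu>)) \<longlongrightarrow> 0) (nhds c)" using tendsto_real_sqrt by fastforce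
    moreover have "\<forall>\<^sub>F \<nu> in nhds c. norm (x0 \<nu> - a) \<le> sqrt (M \<nu>)"
      using near
    proof eventually_elim
      case (elim \<nu>)
      have sq: "norm (y - x) \<le> sqrt B \<and> norm (x - y) \<le> sqrt B"
        if "0 < x" "x < y" "y\<^sup>2 - x\<^sup>2 \<le> B" for x y B :: real
      proof -
        have "(y - x)\<^sup>2 \<le> y\<^sup>2 - x\<^sup>2"
          using mult_left_mono[of x y x] that by (simp add: power2_eq_square algebra_simps)
        then have "y - x \<le> sqrt B" using that by (intro real_le_rsqrt) simp
        then show ?thesis using that by simp
      qed
      consider "\<nu> < c" | "\<nu> = c" | "c < \<nu>" by linarith
      then show ?case
      proof cases
        case 1
        then show ?thesis using diff[of \<nu> c] sq[of a "x0 \<nu>" "M \<nu>"] elim c a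
          by (simp add: M_def a_def)
      next
        case 3
        then show ?thesis using diff[of c \<nu>] sq[of "x0 \<nu>" a "M \<nu>"] elim c x0[of \<nu>]
          by (simp add: M_def a_def)
      qed (use c in \<open>simp add: a_def M_def\<close>)
    qed
    ultimately have "((\<lambda>\<nu>. x0 \<nu> - a) \<longlongrightarrow> 0) (nhds c)" by (rule Lim_null_comparison[rotated])
    then show ?thesis by (simp add: LIM_zero_iff)
  qed
  let ?a = "complex_of_real (a + 1/2)" and ?c = "complex_of_real c"
  obtain e where e: "e > 0"
    and ce: "continuous_on (ball ?a e \<times> ball ?c e) (\<lambda>(s, v). char_fun s v)"
    and he: "\<And>U f g. open U \<Longrightarrow> f holomorphic_on U \<Longrightarrow> g holomorphic_on U \<Longrightarrow> f ` U \<subseteq> ball ?a e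
        \<Longrightarrow> g ` U \<subseteq> ball ?c e \<Longrightarrow> (\<lambda>w. char_fun (f w) (g w)) holomorphic_on U"
    by (rule char_fun_regular[of "a + 1/2" c]) (use a c in simp, use c in simp, rule that)
  have zero: "char_fun ?a ?c = 0" using char_fun_of_real[of a c] a c by simp
  have "(\<lambda>s. char_fun s ?c) holomorphic_on ball ?a e"
    by (rule he[of "ball ?a e" "\<lambda>s. s" "\<lambda>s. ?c"]) (use e in auto)
  then obtain D where D: "((\<lambda>s. char_fun s ?c) has_field_derivative D) (at ?a)"
    using e by (meson centre_in_ball field_differentiable_def holomorphic_on_imp_differentiable_at open_ball)
  have "D \<noteq> 0"
  proof
    assume "D = 0"
    \<comment> \<open>\<open>L\<close> is the Lipschitz constant of the curve to the right of
      \<open>c\<close>: divide the bound on \<open>a\<^sup>2 - y\<^sup>2\<close> by \<open>a\<close>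
      and use \<open>\<nu> + c \<le> 1\<close>. \<open>K\<close> bounds the growth rate in \<nu>
      from below: half of \<open>1/2 - a\<close>, times the 1/4 from
      \<open>q1, q2 \<le> 2\<close>.\<close>
    define L where "L = 1 / (4 * a * c\<^sup>2)"
    define K where "K = (1/2 - a) / 8"
    have LK: "L > 0" "K > 0" using a c by (auto simp: L_def K_def)
    have "((\<lambda>y. (char_fun y ?c - char_fun ?a ?c) / (y - ?a)) \<longlongrightarrow> 0) (at ?a)"
      using D \<open>D = 0\<close> by (simp add: has_field_derivative_iff)
    \<comment> \<open>Chosen so that a vanishing derivative gives
      \<open>\<bar>hypF y c\<bar> < K * (\<nu> - c) / 2\<close>, half of the lower bound forced by
      growth in \<nu>.\<close>
    then have "\<forall>\<^sub>F y in at ?a. dist ((char_fun y ?c - char_fun ?a ?c) / (y - ?a)) 0 < K / (2 * L)"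
      using LK by (intro tendstoD) auto
    then obtain d where d: "d > 0" "\<And>y. y \<noteq> ?a \<Longrightarrow> dist y ?a < d \<Longrightarrow>
        norm ((char_fun y ?c - char_fun ?a ?c) / (y - ?a)) < K / (2 * L)"
      unfolding eventually_at by auto
    have "\<forall>\<^sub>F \<nu> in nhds c. dist (x0 \<nu>) a < d" using cont d(1) by (rule tendstoD)
    with near have "\<forall>\<^sub>F \<nu> in nhds c. \<nu> \<in> {0<..<\<nu>0} \<and> dist (x0 \<nu>) a < d"
      by (rule eventually_conj)
    then have "\<forall>\<^sub>F \<nu> in at_right c. \<nu> \<in> {0<..<\<nu>0} \<and> dist (x0 \<nu>) a < d"
      by (rule filter_leD[rotated]) (simp add: at_within_def)
    moreover have "\<forall>\<^sub>F \<nu> in at_right c. c < \<nu>" by (rule eventually_at_right_less)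
    ultimately have "\<forall>\<^sub>F \<nu> in at_right c. (\<nu> \<in> {0<..<\<nu>0} \<and> dist (x0 \<nu>) a < d) \<and> c < \<nu>"
      by (rule eventually_conj)
    then have "\<exists>\<nu>. (\<nu> \<in> {0<..<\<nu>0} \<and> dist (x0 \<nu>) a < d) \<and> c < \<nu>"
      by (rule eventually_happens'[OF trivial_limit_at_right_real])
    then obtain \<nu> where \<nu>: "0 < \<nu>" "\<nu> < \<nu>0" "dist (x0 \<nu>) a < d" "c < \<nu>"
      by auto
    define y where "y = x0 \<nu>"
    have y: "0 < y" "y < 1/2" "hypF y \<nu> = 0" using x0[OF \<nu>(1,2)] by (auto simp: y_def)
    have ya: "y < a" "a\<^sup>2 - y\<^sup>2 \<le> ((\<nu> / c)\<^sup>2 - 1) / 4"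
      using diff[OF c(1) \<nu>(4,2)] by (auto simp: y_def a_def)
    have "(a - y) * a \<le> (a - y) * (a + y)" using ya y by (intro mult_left_mono) auto
    also have "\<dots> = a\<^sup>2 - y\<^sup>2" by (simp add: power2_eq_square algebra_simps)
    also have "\<dots> \<le> ((\<nu> / c)\<^sup>2 - 1) / 4" by (rule ya)
    also have "\<dots> = (\<nu> - c) * (\<nu> + c) / (4 * c\<^sup>2)"
      using c by (simp add: power2_eq_square field_simps)
    also have "\<dots> \<le> (\<nu> - c) * 1 / (4 * c\<^sup>2)"
      using \<nu> c \<nu>0 by (intro divide_right_mono mult_left_mono) auto
    also have "\<dots> = (\<nu> - c) * L * a" using a by (simp add: L_def)
    finally have lip: "a - y \<le> (\<nu> - c) * L" using a by simp
    have "K * (\<nu> - c) \<le> hypF y \<nu> - hypF y c"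
    proof -
      define q1 q2 where "q1 = y + c + 1/2" and "q2 = y + \<nu> + 1/2"
      have q: "0 < q1" "q1 \<le> 2" "0 < q2" "q2 \<le> 2" using y c \<nu> \<nu>0 by (auto simp: q1_def q2_def)
      have "q1 * q2 \<le> 2 * 2" using q by (intro mult_mono) auto
      then have "(\<nu> - c) / 4 \<le> (\<nu> - c) / (q1 * q2)" using q \<nu> by (intro divide_left_mono) auto
      also have "\<dots> = 1 / q1 - 1 / q2" using q by (simp add: field_simps) (simp add: q1_def q2_def)
      finally have 1: "(\<nu> - c) / 4 \<le> 1 / q1 - 1 / q2" .
      have "(1/2 - a) * 1 \<le> (1/2 - y) * (y + 3/2)" using ya y a by (intro mult_mono) auto
      then have "(1/2 - a) / 2 * ((\<nu> - c) / 4) \<le> (1/2 - y) * (y + 3/2) / 2 * (1 / q1 - 1 / q2)"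
        using 1 a \<nu> y by (intro mult_mono) auto
      also have "\<dots> \<le> hypF y \<nu> - hypF y c"
        unfolding q1_def q2_def by (rule hypF_increase) (use y c \<nu> in auto)
      finally show ?thesis by (simp add: K_def)
    qed
    then have up: "K * (\<nu> - c) \<le> \<bar>hypF y c\<bar>" using y by simp
    have "norm ((char_fun (of_real (y + 1/2)) ?c - char_fun ?a ?c) / (of_real (y + 1/2) - ?a)) < K / (2 * L)"
    proof (rule d(2))
      show "complex_of_real (y + 1/2) \<noteq> ?a" using ya by (simp only: of_real_eq_iff)
      have "of_real (y + 1/2) - ?a = of_real (y - a)" by simp
      then show "dist (of_real (y + 1/2)) ?a < d"
        using \<nu>(3) unfolding dist_norm y_def by (metis norm_of_real real_norm_def)
    qed
    also have "char_fun (of_real (y + 1/2)) ?c = of_real (hypF y c)"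
      using char_fun_of_real[of y c] y c by simp
    also have "(of_real (hypF y c) - char_fun ?a ?c) / (of_real (y + 1/2) - ?a)
        = complex_of_real (hypF y c / (y - a))" by (simp add: zero[simplified])
    finally have "\<bar>hypF y c\<bar> / (a - y) < K / (2 * L)" using ya by (simp only: norm_of_real abs_divide) simp
    then have "\<bar>hypF y c\<bar> < K / (2 * L) * (a - y)" using ya by (simp add: pos_divide_less_eq)
    also have "\<dots> \<le> K / (2 * L) * ((\<nu> - c) * L)"
      using LK lip by (intro mult_left_mono) auto
    also have "\<dots> = K * (\<nu> - c) / 2" using LK by simp
    finally have "K * (\<nu> - c) < K * (\<nu> - c) / 2" using up by linarith
    moreover have "K * (\<nu> - c) > 0" using LK \<nu> by simp
    ultimately show False by simp
  qed
  obtain r \<rho> h where r: "r > 0" "\<rho> > 0" and h: "h holomorphic_on ball ?c r"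
    and uniq: "\<And>s v. v \<in> ball ?c r \<Longrightarrow> s \<in> cball ?a \<rho> \<Longrightarrow> char_fun s v = 0 \<Longrightarrow> s = h v"
    by (rule holomorphic_implicit_function[OF e ce he zero D \<open>D \<noteq> 0\<close>]) (assumption+, rule that)
  have "h analytic_on {?c}"
    using h r by (meson analytic_on_analytic_at analytic_on_holomorphic centre_in_ball empty_subsetI insert_subset open_ball)
  then have "(\<lambda>w. h (?c + w)) analytic_on {0}"
    by (intro analytic_on_compose[unfolded o_def, of "\<lambda>w. ?c + w" _ h]) (auto intro!: analytic_intros)
  then obtain H where "(\<lambda>w. h (?c + w)) has_fps_expansion H"
    using analytic_at_imp_has_fps_expansion_0 by blast
  then have "(\<lambda>t. Re (h (?c + of_real t))) has_fps_expansion Abs_fps (\<lambda>n. Re (fps_nth H n))"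
    by (rule has_fps_expansion_Re)
  then have E: "(\<lambda>t. Re (h (?c + of_real t)) - 1/2) has_fps_expansion
      (Abs_fps (\<lambda>n. Re (fps_nth H n)) - fps_const (1/2))"
    by (intro fps_expansion_intros)
  \<comment> \<open>By continuity \<open>x0\<close> stays in the disc of uniqueness, so it agrees
    with \<open>h\<close> near \<open>c\<close>.\<close>
  have "\<forall>\<^sub>F \<nu> in nhds c. dist (x0 \<nu>) a < \<rho>" using cont r(2) by (rule tendstoD)
  moreover have "\<forall>\<^sub>F \<nu> in nhds c. \<nu> \<in> ball c r" using r by (intro eventually_nhds_in_open) auto
  ultimately have "\<forall>\<^sub>F \<nu> in nhds c. x0 \<nu> = Re (h (of_real \<nu>)) - 1/2"
    using near
  proof eventually_elim
    case (elim \<nu>)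
    have "of_real (x0 \<nu> + 1/2) = h (of_real \<nu>)"
    proof (rule uniq)
      show "complex_of_real \<nu> \<in> ball ?c r"
        using elim(2) by (simp add: dist_norm flip: of_real_diff)
      have "?a - of_real (x0 \<nu> + 1/2) = of_real (a - x0 \<nu>)" by simp
      then show "of_real (x0 \<nu> + 1/2) \<in> cball ?a \<rho>"
        using elim(1) unfolding mem_cball dist_norm
        by (metis abs_minus_commute less_imp_le norm_of_real real_norm_def)
      show "char_fun (of_real (x0 \<nu> + 1/2)) (of_real \<nu>) = 0"
        using char_fun_of_real[of "x0 \<nu>" \<nu>] x0[of \<nu>] elim(3) by simp
    qed
    then have "h (of_real \<nu>) = of_real (x0 \<nu> + 1/2)" by simp
    then show ?case by (simp only: Re_complex_of_real)
  qed
  then have "\<forall>\<^sub>F t in nhds 0. x0 (c + t) = Re (h (?c + of_real t)) - 1/2"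
    by (simp add: nhds_to_0'[of c] eventually_filtermap add.commute)
  then have "\<forall>\<^sub>F t in nhds 0. Re (h (?c + of_real t)) - 1/2 = x0 (c + t)"
    by eventually_elim simp
  from has_fps_expansion_cong[OF this refl] E show ?thesis by blast
qed

theorem theorem29:
  shows "\<exists>(\<nu>\<^sub>0::real) (x\<^sub>0 :: real \<Rightarrow> real).
    {\<nu>::real. \<nu> > 0 \<and> hyp3F2_at_1 (-1/2) (1/2) (3/2) 1 (\<nu> + 1/2) = 0} = {\<nu>\<^sub>0} \<and>
    \<nu>\<^sub>0 \<in> {0<..<1/2} \<and>
    (\<forall>\<nu>\<in>{0<..<\<nu>\<^sub>0}.
      {x \<in> {0<..<1/2}.
         hyp3F2_at_1 (x - 1/2) (x + 1/2) (x + 3/2) (2 * x + 1) (x + \<nu> + 1/2) = 0} = {x\<^sub>0 \<nu>}) \<and>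
    (\<forall>\<nu>>0. point_spectrum (jacobi_dom \<nu>) (jacobi_op \<nu>) =
      (if \<nu> \<ge> \<nu>\<^sub>0 then {} else {complex_of_real (1/4 - (x\<^sub>0 \<nu>)\<^sup>2)})) \<and>
    real_analytic_on x\<^sub>0 {0<..<\<nu>\<^sub>0} \<and>
    strict_antimono_on {0<..<\<nu>\<^sub>0} x\<^sub>0"
proof -
  obtain \<nu>0 where \<nu>0: "0 < \<nu>0" "\<nu>0 < 1/2" and thr: "\<And>\<nu>. \<nu> > 0 \<Longrightarrow> hypF 0 \<nu> = 0 \<longleftrightarrow> \<nu> = \<nu>0"
    and neg: "\<And>\<nu>. 0 < \<nu> \<Longrightarrow> \<nu> < \<nu>0 \<Longrightarrow> hypF 0 \<nu> < 0"
    by (rule ex1_threshold) (rule that)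
  have "\<exists>x. 0 < x \<and> x < 1/2 \<and> hypF x \<nu> = 0" if "0 < \<nu>" "\<nu> < \<nu>0" for \<nu>
    using ex_zero[OF that(1) neg[OF that]] by blast
  then obtain x0 where x0: "\<And>\<nu>. 0 < \<nu> \<Longrightarrow> \<nu> < \<nu>0 \<Longrightarrow> 0 < x0 \<nu> \<and> x0 \<nu> < 1/2 \<and> hypF (x0 \<nu>) \<nu> = 0"
    by metis
  have uniq: "x = x0 \<nu>" if "0 < \<nu>" "\<nu> < \<nu>0" "0 < x" "x < 1/2" "hypF x \<nu> = 0" for x \<nu>
    using zero_comparison_same[of x "x0 \<nu>" \<nu>] x0[of \<nu>] that by auto
  \<comment> \<open>Comparison with the zero \<open>x = 0\<close> at \<open>\<nu>0\<close>: equal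
    parameters would give \<open>x = 0\<close>, a larger one \<open>x < 0\<close>.\<close>
  have none: "hypF x \<nu> \<noteq> 0" if "\<nu> \<ge> \<nu>0" "0 < x" "x < 1/2" for x \<nu>
  proof
    assume z: "hypF x \<nu> = 0"
    have z0: "hypF 0 \<nu>0 = 0" using thr \<nu>0 by simp
    show False
    proof (cases "\<nu> = \<nu>0")
      case True
      then show False using zero_comparison_same[of x 0 \<nu>0] z z0 that \<nu>0 by simp
    next
      case False
      then show False using zero_comparison_less(1)[of 0 x \<nu>0 \<nu>] z z0 that \<nu>0 by simp
    qed
  qed
  have "{\<nu>::real. \<nu> > 0 \<and> hyp3F2_at_1 (-1/2) (1/2) (3/2) 1 (\<nu> + 1/2) = 0} = {\<nu>0}"
    using thr \<nu>0 by (auto simp: hypF_def)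
  moreover have "\<forall>\<nu>\<in>{0<..<\<nu>0}. {x \<in> {0<..<1/2}.
         hyp3F2_at_1 (x - 1/2) (x + 1/2) (x + 3/2) (2 * x + 1) (x + \<nu> + 1/2) = 0} = {x0 \<nu>}"
    using x0 uniq by (auto simp flip: hypF_def)
  moreover have "\<forall>\<nu>>0. point_spectrum (jacobi_dom \<nu>) (jacobi_op \<nu>) =
      (if \<nu> \<ge> \<nu>0 then {} else {complex_of_real (1/4 - (x0 \<nu>)\<^sup>2)})"
  proof (intro allI impI)
    fix \<nu> :: real assume \<nu>: "\<nu> > 0"
    show "point_spectrum (jacobi_dom \<nu>) (jacobi_op \<nu>) =
      (if \<nu> \<ge> \<nu>0 then {} else {complex_of_real (1/4 - (x0 \<nu>)\<^sup>2)})"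
    proof (cases "\<nu> \<ge> \<nu>0")
      case True
      then show ?thesis unfolding point_spectrum_jacobi[OF \<nu>] using none by auto
    next
      case False
      then have "x \<in> {0<..<1/2} \<and> hypF x \<nu> = 0 \<longleftrightarrow> x = x0 \<nu>" for x using x0 uniq \<nu> by auto
      with False show ?thesis by (simp only: point_spectrum_jacobi[OF \<nu>] if_False simp_thms) simp
    qed
  qed
  moreover have "real_analytic_on x0 {0<..<\<nu>0}"
    unfolding real_analytic_on_def using real_analytic_at_zero_curve[OF _ _ \<nu>0(2) x0] by auto
  moreover have "strict_antimono_on {0<..<\<nu>0} x0"
  proof (rule monotone_onI)
    fix \<nu>1 \<nu>2 assume "\<nu>1 \<in> {0<..<\<nu>0}" "\<nu>2 \<in> {0<..<\<nu>0}" "\<nu>1 < \<nu>2"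
    then show "x0 \<nu>1 > x0 \<nu>2"
      using zero_comparison_less(1)[of "x0 \<nu>1" "x0 \<nu>2" \<nu>1 \<nu>2] x0[of \<nu>1] x0[of \<nu>2] by auto
  qed
  ultimately show ?thesis using \<nu>0 by (intro exI[of _ \<nu>0] exI[of _ x0]) auto
qed

end
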